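(* Fix $d\ge2$. For every $m\ge1$ let $G^{(m)}=(V^{(m)},E^{(m)})$ be a finite $d$-uniform hypergraph, and let $\mathbf{P}^{(m)}$ be the probability measure on the hypergraph universal space $(\Omega,\mathcal{B}_{\max})$ given by the law of the random infinite hypergraph $E^{(m)}_\infty:=\{e\in\binom{\mathbf{N}}{d}:\{x^{(m)}_i:i\in e\}\in E^{(m)}\}$, where $x^{(m)}_1,x^{(m)}_2,\ldots$ are i.i.d. uniform on $V^{(m)}$. Then there exist a subsequence $0<m_1<m_2<\cdots$ and a probability measure $\mathbf{P}^{(\infty)}$ on $(\Omega,\mathcal{B}_{\max})$ such that $\lim_{i\to\infty}\mathbf{P}^{(m_i)}(E)=\mathbf{P}^{(\infty)}(E)$ for all $E\in\mathcal{B}_{\mathrm{reg}}$, $\mathbf{P}^{(\infty)}(\sigma E)=\mathbf{P}^{(\infty)}(E)$ for all $E\in\mathcal{B}_{\max}$ and $\sigma\in S_\infty$, and moreover: for any $I,I_1,\ldots,I_l\subseteq\mathbf{N}$ with $I\cap I_1\cap\cdots\cap I_l$ infinite, the $\sigma$-algebras $\mathcal{B}_I$ and $\bigvee_{i=1}^l\mathcal{B}_{I_i}$ are relatively independent conditioning on $\bigvee_{i=1}^l\mathcal{B}_{I\cap I_i}$ with respect to $\mathbf{P}^{(\infty)}$.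
   Context: A $d$-uniform hypergraph is a pair $(V,E)$ with $V$ a nonempty set and $E\subseteq\binom{V}{d}$, the $d$-element subsets of $V$. $\mathbf{N}=\{1,2,\ldots\}$. The hypergraph universal space is $\Omega=\{E_\infty:E_\infty\subseteq\binom{\mathbf{N}}{d}\}$. For $e\in\binom{\mathbf{N}}{d}$, $A_e=\{E_\infty:e\in E_\infty\}$; $\mathcal{B}_{\max}$ is the $\sigma$-algebra generated by the $A_e$ and $\mathcal{B}_{\mathrm{reg}}$ the algebra they generate (finite Boolean combinations). For $I\subseteq\mathbf{N}$, $\mathcal{B}_I$ is the $\sigma$-algebra generated by $A_e$, $e\in\binom{I}{d}$. $S_\infty$ is the group of all permutations of $\mathbf{N}$, acting by $\sigma A_e=A_{\sigma(e)}$. If $\{x^{(m)}_i:i\in e\}$ has fewer than $d$ elements it is not an edge. $\bigvee$ is the generated $\sigma$-algebra (empty join $=\{\emptyset,\Omega\}$). Relative independence of $\mathcal{B}_1,\mathcal{B}_2$ conditioning on $\mathcal{B}$ means $\mathbf{E}(f_1f_2\mid\mathcal{B})=\mathbf{E}(f_1\mid\mathcal{B})\mathbf{E}(f_2\mid\mathcal{B})$ a.s. for all bounded $\mathcal{B}_1$-measurable $f_1$ and $\mathcal{B}_2$-measurable $f_2$. *)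

theory Defs
  imports "HOL-Probability.Probability" "HOL-Library.Ramsey" "HOL-Combinatorics.Permutations"
    "HOL.Hull"
begin

definition uniform_hypergraph :: "nat \<Rightarrow> 'a set \<Rightarrow> 'a set set \<Rightarrow> bool" where
  "uniform_hypergraph d V E \<longleftrightarrow> V \<noteq> {} \<and> E \<subseteq> nsets V d"

abbreviation PosNat :: "nat set" where
  "PosNat \<equiv> {1..}"

text \<open>The points of the universal space are the edge sets on the positive integers.\<close>

definition Univ :: "nat \<Rightarrow> nat set set set" where
  "Univ d = Pow (nsets PosNat d)"

definition edge_event :: "nat \<Rightarrow> nat set \<Rightarrow> nat set set set" where
  "edge_event d e = {H \<in> Univ d. e \<in> H}"

definition B_sub :: "nat \<Rightarrow> nat set \<Rightarrow> nat set set set set" where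
  "B_sub d I = sigma_sets (Univ d) (edge_event d ` nsets I d)"

definition B_max :: "nat \<Rightarrow> nat set set set set" where
  "B_max d = sigma_sets (Univ d) (edge_event d ` nsets PosNat d)"

definition B_reg :: "nat \<Rightarrow> nat set set set set" where
  "B_reg d = algebra (Univ d) hull (edge_event d ` nsets PosNat d)"

text \<open>For an empty index set the join is the trivial \<open>\<sigma>\<close>-algebra.\<close>

definition B_join :: "nat \<Rightarrow> 'i set \<Rightarrow> ('i \<Rightarrow> nat set set set set) \<Rightarrow> nat set set set set" where
  "B_join d K \<B> = sigma_sets (Univ d) (\<Union>i\<in>K. \<B> i)"

text \<open>A permutation acts on an event by relabelling the vertices of each of its points.\<close>

definition perm_event :: "(nat \<Rightarrow> nat) \<Rightarrow> nat set set set \<Rightarrow> nat set set set" where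
  "perm_event \<sigma> A = (\<lambda>H. (\<lambda>e. \<sigma> ` e) ` H) ` A"

lemma perm_event_edge_event:
  assumes "\<sigma> permutes PosNat"
  shows "perm_event \<sigma> (edge_event d e) = edge_event d (\<sigma> ` e)"
proof -
  have im: "\<tau> ` a \<in> nsets PosNat d" if \<tau>: "\<tau> permutes PosNat" and a: "a \<in> nsets PosNat d" for \<tau> a
  proof -
    have "\<tau> ` a \<subseteq> PosNat"
      using a permutes_image[OF \<tau>] unfolding nsets_def by blast
    moreover have "card (\<tau> ` a) = card a"
      using permutes_inj_on[OF \<tau>] by (rule card_image)
    ultimately show ?thesis
      using a by (simp add: nsets_def)
  qed
  define \<tau> where "\<tau> = inv \<sigma>"
  have \<tau>: "\<tau> permutes PosNat"
    unfolding \<tau>_def using assms by (rule permutes_inv)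
  have st: "\<sigma> ` \<tau> ` a = a" for a
    unfolding \<tau>_def image_image using permutes_inverses(1)[OF assms] by simp
  show ?thesis
  proof
    show "perm_event \<sigma> (edge_event d e) \<subseteq> edge_event d (\<sigma> ` e)"
      using im[OF assms] by (auto simp: perm_event_def edge_event_def Univ_def)
    show "edge_event d (\<sigma> ` e) \<subseteq> perm_event \<sigma> (edge_event d e)"
    proof
      fix H assume H: "H \<in> edge_event d (\<sigma> ` e)"
      have "\<tau> ` \<sigma> ` e = e"
        unfolding \<tau>_def image_image using permutes_inverses(2)[OF assms] by simp
      moreover have "\<tau> ` \<sigma> ` e \<in> (\<lambda>a. \<tau> ` a) ` H"
        using H by (intro imageI) (simp add: edge_event_def)
      ultimately have "e \<in> (\<lambda>a. \<tau> ` a) ` H"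
        by simp
      then have "(\<lambda>a. \<tau> ` a) ` H \<in> edge_event d e"
        using H im[OF \<tau>] by (auto simp: edge_event_def Univ_def)
      moreover have "H = (\<lambda>a. \<sigma> ` a) ` (\<lambda>a. \<tau> ` a) ` H"
        unfolding image_image[of "\<lambda>a. \<sigma> ` a"] st by simp
      ultimately show "H \<in> perm_event \<sigma> (edge_event d e)"
        unfolding perm_event_def by (rule rev_image_eqI)
    qed
  qed
qed

definition sampled_edges :: "nat \<Rightarrow> 'a set set \<Rightarrow> (nat \<Rightarrow> 'a) \<Rightarrow> nat set set" where
  "sampled_edges d E x = {e \<in> nsets PosNat d. x ` e \<in> E}"

text \<open>Under the product measure the coordinates are i.i.d. uniform on \<open>V\<close>.\<close>

definition sample_law :: "nat \<Rightarrow> 'a set \<Rightarrow> 'a set set \<Rightarrow> nat set set measure" where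
  "sample_law d V E =
     distr (PiM PosNat (\<lambda>_. uniform_count_measure V)) (sigma (Univ d) (B_max d)) (sampled_edges d E)"

lemma sampled_edges_measurable:
  assumes "finite V"
  shows "sampled_edges d E \<in> measurable (PiM PosNat (\<lambda>_. uniform_count_measure V)) (sigma (Univ d) (B_max d))"
proof -
  let ?M = "PiM PosNat (\<lambda>_. uniform_count_measure V)"
  have gen_sub: "edge_event d ` nsets PosNat d \<subseteq> Pow (Univ d)"
    by (auto simp: edge_event_def)
  have sigma_sets_subset_Pow: "sigma_sets (Univ d) (edge_event d ` nsets PosNat d) \<subseteq> Pow (Univ d)"
    using sigma_sets_into_sp[OF gen_sub] by blast
  have gen: "sigma (Univ d) (B_max d) = sigma (Univ d) (edge_event d ` nsets PosNat d)"
    unfolding B_max_def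
    by (intro sigma_eqI sigma_sets_sigma_sets_eq gen_sub sigma_sets_subset_Pow)
  show ?thesis
    unfolding gen
  proof (rule measurable_measure_of)
    show "edge_event d ` nsets PosNat d \<subseteq> Pow (Univ d)"
      by (rule gen_sub)
    show "sampled_edges d E \<in> space ?M \<rightarrow> Univ d"
      by (auto simp: sampled_edges_def Univ_def)
    fix A assume "A \<in> edge_event d ` nsets PosNat d"
    then obtain e where e: "e \<in> nsets PosNat d" and A: "A = edge_event d e"
      by auto
    have fin: "finite e" and sub: "e \<subseteq> PosNat"
      using e by (auto simp: nsets_def)
    let ?N = "PiM e (\<lambda>_. count_space V)"
    have N: "?N = count_space (e \<rightarrow>\<^sub>E V)"
      by (rule count_space_PiM_finite) (use fin assms in \<open>auto simp: countable_finite\<close>)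
    have "(\<lambda>x. restrict x e) \<in> measurable ?M (PiM e (\<lambda>_. uniform_count_measure V))"
      by (rule measurable_restrict_subset[OF sub])
    also have "measurable ?M (PiM e (\<lambda>_. uniform_count_measure V)) = measurable ?M ?N"
      by (intro measurable_cong_sets sets_PiM_cong) (auto simp: sets_uniform_count_measure)
    finally have "(\<lambda>x. restrict x e) \<in> measurable ?M (count_space (e \<rightarrow>\<^sub>E V))"
      unfolding N .
    then have "(\<lambda>x. restrict x e) -` {y \<in> e \<rightarrow>\<^sub>E V. y ` e \<in> E} \<inter> space ?M \<in> sets ?M"
      by (rule measurable_sets) auto
    also have "(\<lambda>x. restrict x e) -` {y \<in> e \<rightarrow>\<^sub>E V. y ` e \<in> E} \<inter> space ?M
        = sampled_edges d E -` A \<inter> space ?M"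
      using e sub unfolding A
      by (auto simp: sampled_edges_def edge_event_def Univ_def space_PiM
          space_uniform_count_measure PiE_def Pi_def extensional_def subset_iff)
    finally show "sampled_edges d E -` A \<inter> space ?M \<in> sets ?M" .
  qed
qed

definition rel_indep ::
  "'a measure \<Rightarrow> 'a set set \<Rightarrow> 'a set set \<Rightarrow> 'a set set \<Rightarrow> bool" where
  "rel_indep P B1 B2 B \<longleftrightarrow>
     (\<forall>f1 f2 :: 'a \<Rightarrow> real.
        f1 \<in> borel_measurable (sigma (space P) B1) \<and> bounded (f1 ` space P) \<and>
        f2 \<in> borel_measurable (sigma (space P) B2) \<and> bounded (f2 ` space P) \<longrightarrow>
        (AE x in P. real_cond_exp P (sigma (space P) B) (\<lambda>y. f1 y * f2 y) x =
           real_cond_exp P (sigma (space P) B) f1 x * real_cond_exp P (sigma (space P) B) f2 x))"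

end

theory Submission
  imports Defs "HOL-Complex_Analysis.Great_Picard"
begin

text \<open>
  The regular events form a countable algebra of events depending on finitely many edges, so a
  diagonal subsequence of the laws converges on it; the limit is a premeasure because the space of
  edge sets is compact.  Each sampled law is exchangeable, and so is the limit.

  For the relative independence, exchangeability alone is used.  Let \<open>f\<close> be
  \<open>\<B>\<^sub>I\<close>-measurable and let \<open>h\<close> be its conditional expectation given
  the join of the \<open>\<B>\<close>-algebras of the sets \<open>I \<inter> I\<^sub>i\<close>.  Both are nearly unchanged in \<open>L\<^sup>1\<close> by every
  relabelling that fixes a large finite subset of \<open>I\<close>.  Given an event \<open>C\<close> prescribing finitely many
  edges, each inside some \<open>I\<^sub>i\<close>, choose such a relabelling that also fixes the vertices of \<open>C\<close> in \<open>I\<close>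
  and sends the others into the infinite set \<open>I \<inter> I\<^sub>1 \<inter> \<dots> \<inter> I\<^sub>l\<close>.  The relabelled event
  \<open>C'\<close> belongs to the conditioning \<open>\<sigma>\<close>-algebra, so \<open>f\<close> and \<open>h\<close> have the same
  integral over \<open>C'\<close>, hence nearly the same integral over \<open>C\<close>.  Thus conditioning \<open>f\<close> on
  the full join yields \<open>h\<close>, and the tower property concludes.
\<close>

section \<open>Regular events and limits of laws\<close>

text \<open>Indexed by a set of edges instead of vertices, because a join of several
  \<open>B_sub d (J i)\<close> is generated by the edges lying inside some \<open>J i\<close>, which
  in general are not all the edges on one vertex set.\<close>

definition B_gen :: "nat \<Rightarrow> nat set set \<Rightarrow> nat set set set set" where
  "B_gen d \<E> = sigma_sets (Univ d) (edge_event d ` \<E>)"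

lemma edge_event_subset: "edge_event d ` \<E> \<subseteq> Pow (Univ d)"
  by (auto simp: edge_event_def)

lemma B_sub_eq_B_gen: "B_sub d I = B_gen d (nsets I d)"
  by (simp add: B_sub_def B_gen_def)

lemma B_max_eq_B_gen: "B_max d = B_gen d (nsets PosNat d)"
  by (simp add: B_max_def B_gen_def)

lemma sigma_algebra_B_gen: "sigma_algebra (Univ d) (B_gen d \<E>)"
  unfolding B_gen_def by (rule sigma_algebra_sigma_sets[OF edge_event_subset])

lemma sets_sigma_B_gen [simp]: "sets (sigma (Univ d) (B_gen d \<E>)) = B_gen d \<E>"
  using sigma_algebra.sets_measure_of_eq[OF sigma_algebra_B_gen] .

lemma B_gen_mono: "\<E> \<subseteq> \<E>' \<Longrightarrow> B_gen d \<E> \<subseteq> B_gen d \<E>'"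
  unfolding B_gen_def by (intro sigma_sets_mono') blast

text \<open>Brings both joins of the independence statement into the form \<open>B_gen\<close>. For
  empty \<open>K\<close> both sides are the trivial sigma-algebra.\<close>

lemma B_join_B_sub: "B_join d K (\<lambda>i. B_sub d (J i)) = B_gen d (\<Union>i\<in>K. nsets (J i) d)"
proof -
  have *: "edge_event d ` (\<Union>i\<in>K. nsets (J i) d) \<subseteq> (\<Union>i\<in>K. B_sub d (J i))"
    by (auto simp: B_sub_def intro: sigma_sets.Basic)
  have "B_sub d (J i) \<subseteq> B_gen d (\<Union>i\<in>K. nsets (J i) d)" if "i \<in> K" for i
    unfolding B_sub_eq_B_gen using that by (intro B_gen_mono) blast
  then show ?thesis
    unfolding B_join_def B_gen_def
    by (intro sigma_sets_eqI) (auto intro: sigma_sets.Basic simp: B_sub_def)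
qed

section \<open>Regular events: finite support and countability\<close>

lemma algebra_B_reg: "algebra (Univ d) (B_reg d)"
proof -
  \<comment> \<open>The hull is an intersection of algebras. The power set is one of them, which
    bounds the hull; the closure properties pass to the intersection.\<close>
  have "B_reg d \<subseteq> Pow (Univ d)"
    unfolding B_reg_def by (intro hull_minimal edge_event_subset algebra_Pow)
  then show ?thesis
    by (auto simp: algebra_iff_Un B_reg_def hull_def)
qed

lemma B_reg_subset_Univ: "A \<in> B_reg d \<Longrightarrow> A \<subseteq> Univ d"
  using algebra_B_reg[of d] unfolding algebra_iff_Un by blast

lemma sigma_sets_B_reg: "sigma_sets (Univ d) (B_reg d) = B_max d"
proof (rule antisym)
  have "B_reg d \<subseteq> B_max d"
    unfolding B_reg_def
    using sigma_algebra_B_gen[of d "nsets PosNat d"]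
    by (intro hull_minimal)
       (auto simp: B_max_eq_B_gen sigma_algebra_def B_gen_def intro: sigma_sets.Basic)
  then show "sigma_sets (Univ d) (B_reg d) \<subseteq> B_max d"
    unfolding B_max_def by (rule sigma_sets_mono)
  show "B_max d \<subseteq> sigma_sets (Univ d) (B_reg d)"
    unfolding B_max_def B_reg_def by (intro sigma_sets_mono' hull_subset)
qed

lemma B_reg_subset_B_max: "B_reg d \<subseteq> B_max d"
  using sigma_sets_B_reg by (auto intro: sigma_sets.Basic)

lemma countable_nsets_PosNat: "countable (nsets PosNat d)"
  by (rule countable_subset[OF _ countable_Collect_finite_subset[of PosNat]]) (auto simp: nsets_def)

text \<open>Events decided by the trace on some finite set of edges form an algebra containing every
  edge event, hence contain the hull. Countability and compactness both rest on this.\<close>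

lemma B_reg_finite_support:
  assumes "A \<in> B_reg d"
  shows "\<exists>S. finite S \<and> S \<subseteq> nsets PosNat d \<and>
    (\<forall>H\<in>Univ d. \<forall>H'\<in>Univ d. H \<inter> S = H' \<inter> S \<longrightarrow> (H \<in> A \<longleftrightarrow> H' \<in> A))"
proof -
  define supp where "supp A S \<longleftrightarrow> finite S \<and> S \<subseteq> nsets PosNat d \<and>
    (\<forall>H\<in>Univ d. \<forall>H'\<in>Univ d. H \<inter> S = H' \<inter> S \<longrightarrow> (H \<in> A \<longleftrightarrow> H' \<in> A))" for A S
  let ?C = "{A. A \<subseteq> Univ d \<and> (\<exists>S. supp A S)}"
  have empty: "supp {} {}"
    by (simp add: supp_def)
  have compl: "supp (Univ d - A) S" if "supp A S" for A S
    using that unfolding supp_def by blast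
  have union: "supp (A \<union> B) (S \<union> T)" if S: "supp A S" and T: "supp B T" for A B S T
    unfolding supp_def
  proof (intro conjI ballI impI)
    fix H H' assume H: "H \<in> Univ d" "H' \<in> Univ d" "H \<inter> (S \<union> T) = H' \<inter> (S \<union> T)"
    then have "H \<inter> S = H' \<inter> S" "H \<inter> T = H' \<inter> T" by blast+
    then have "H \<in> A \<longleftrightarrow> H' \<in> A" "H \<in> B \<longleftrightarrow> H' \<in> B"
      using S T H(1,2) unfolding supp_def by blast+
    then show "(H \<in> A \<union> B) = (H' \<in> A \<union> B)" by simp
  next
    show "finite (S \<union> T)" "S \<union> T \<subseteq> nsets PosNat d"
      using S T unfolding supp_def by blast+
  qed
  have "algebra (Univ d) ?C"
    unfolding algebra_iff_Un using empty compl union by blast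
  moreover have "supp (edge_event d e) {e}" if "e \<in> nsets PosNat d" for e
    using that unfolding supp_def edge_event_def by blast
  then have "edge_event d ` nsets PosNat d \<subseteq> ?C"
    using edge_event_subset by blast
  ultimately have "B_reg d \<subseteq> ?C"
    unfolding B_reg_def by (intro hull_minimal)
  then have "\<exists>S. supp A S"
    using assms by blast
  then show ?thesis
    unfolding supp_def .
qed

text \<open>A regular event is coded by a finite support and the finitely many traces its members
  leave there; there are countably many such codes.\<close>

lemma countable_B_reg: "countable (B_reg d)"
proof (rule countable_subset)
  let ?fin = "\<lambda>T. {A. finite A \<and> A \<subseteq> T}"
  let ?N = "?fin (nsets PosNat d)"
  let ?c = "\<lambda>(S, \<T>). {H \<in> Univ d. H \<inter> S \<in> \<T>}"
  show "countable (?c ` (?N \<times> ?fin ?N))"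
    by (intro countable_image countable_SIGMA countable_Collect_finite_subset countable_nsets_PosNat)
  show "B_reg d \<subseteq> ?c ` (?N \<times> ?fin ?N)"
  proof
    fix A assume A: "A \<in> B_reg d"
    obtain S where S: "finite S" "S \<subseteq> nsets PosNat d"
      "\<forall>H\<in>Univ d. \<forall>H'\<in>Univ d. H \<inter> S = H' \<inter> S \<longrightarrow> (H \<in> A \<longleftrightarrow> H' \<in> A)"
      using B_reg_finite_support[OF A] by (elim exE conjE)
    have AU: "A \<subseteq> Univ d"
      using A by (rule B_reg_subset_Univ)
    \<comment> \<open>Any \<open>H\<close> sharing its trace on \<open>S\<close> with a member of
      \<open>A\<close> is itself in \<open>A\<close>, so the traces recover
      \<open>A\<close>.\<close>
    have "A = ?c (S, (\<lambda>H. H \<inter> S) ` A)"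
      using S(3) AU by blast
    moreover have "finite ((\<lambda>H. H \<inter> S) ` A)"
      by (rule finite_subset[of _ "Pow S"]) (use S in auto)
    moreover have "(\<lambda>H. H \<inter> S) ` A \<subseteq> ?N"
      using S by auto
    ultimately show "A \<in> ?c ` (?N \<times> ?fin ?N)"
      using S by blast
  qed
qed

section \<open>Compactness of the universal space and the limiting measure\<close>

text \<open>Sequential compactness of a countable product of two-point spaces: points chosen from
  the \<open>A n\<close> have an edgewise convergent subsequence, and its limit lies in every
  \<open>A m\<close> because \<open>A m\<close> looks at finitely many edges only.\<close>

lemma B_reg_compact:
  assumes A: "range A \<subseteq> B_reg d" and dec: "decseq A" and ne: "\<And>n. A n \<noteq> {}"
  shows "(\<Inter>n. A n) \<noteq> {}"
proof -
  have AU: "A n \<subseteq> Univ d" for n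
    using A B_reg_subset_Univ by blast
  have "\<forall>n. \<exists>H. H \<in> A n" using ne by blast
  then obtain H where H: "\<And>n. H n \<in> A n" by metis
  \<comment> \<open>Edge membership is coded as a real number 0 or 1, so the diagonal argument for
    functions bounded by 1 on a countable set applies.\<close>
  obtain k :: "nat \<Rightarrow> nat" where k: "strict_mono k"
    and conv: "\<And>e. e \<in> nsets PosNat d \<Longrightarrow> \<exists>l. (\<lambda>n. of_bool (e \<in> H (k n)) :: real) \<longlonglongrightarrow> l"
    by (rule function_convergent_subsequence[OF countable_nsets_PosNat[of d],
          of "\<lambda>n e. of_bool (e \<in> H n) :: real" 1]) auto
  define L where "L = {e \<in> nsets PosNat d. eventually (\<lambda>n. e \<in> H (k n)) sequentially}"
  have ev: "eventually (\<lambda>n. e \<in> H (k n) \<longleftrightarrow> e \<in> L) sequentially" if e: "e \<in> nsets PosNat d" for e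
  proof -
    obtain l where "(\<lambda>n. of_bool (e \<in> H (k n)) :: real) \<longlonglongrightarrow> l" using conv[OF e] by blast
    then have "Cauchy (\<lambda>n. of_bool (e \<in> H (k n)) :: real)" by (rule LIMSEQ_imp_Cauchy)
    then obtain M where M: "\<And>m n. m \<ge> M \<Longrightarrow> n \<ge> M \<Longrightarrow>
        dist (of_bool (e \<in> H (k m)) :: real) (of_bool (e \<in> H (k n))) < 1"
      using metric_CauchyD[OF _ zero_less_one, of "\<lambda>n. of_bool (e \<in> H (k n)) :: real"] by blast
    \<comment> \<open>Two values in {0, 1} at distance less than 1 coincide, so the Cauchy sequence
      is constant from \<open>M\<close> on.\<close>
    have const: "e \<in> H (k n) \<longleftrightarrow> e \<in> H (k M)" if "n \<ge> M" for n
      using M[of n M] that by (auto simp: of_bool_def split: if_splits)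
    show ?thesis
    proof (cases "e \<in> H (k M)")
      case True
      then have "eventually (\<lambda>n. e \<in> H (k n)) sequentially"
        using const by (intro eventually_sequentiallyI[of M]) blast
      then show ?thesis
        using e by (auto simp: L_def)
    next
      case False
      then have *: "eventually (\<lambda>n. e \<notin> H (k n)) sequentially"
        using const by (intro eventually_sequentiallyI[of M]) blast
      have "e \<notin> L"
      proof
        assume "e \<in> L"
        then have "eventually (\<lambda>n. e \<in> H (k n) \<and> e \<notin> H (k n)) sequentially"
          using * unfolding L_def by (intro eventually_conj) blast+
        then show False by simp
      qed
      then show ?thesis using * by simp
    qed
  qed
  have "L \<in> A m" for m
  proof -
    have Am: "A m \<in> B_reg d" using A by blast
    obtain S where S: "finite S" "S \<subseteq> nsets PosNat d"
      "\<forall>H\<in>Univ d. \<forall>H'\<in>Univ d. H \<inter> S = H' \<inter> S \<longrightarrow> (H \<in> A m \<longleftrightarrow> H' \<in> A m)"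
      using B_reg_finite_support[OF Am] by (elim exE conjE)
    have "\<forall>e\<in>S. eventually (\<lambda>n. e \<in> H (k n) \<longleftrightarrow> e \<in> L) sequentially"
      using S(2) ev by blast
    then have "eventually (\<lambda>n. \<forall>e\<in>S. e \<in> H (k n) \<longleftrightarrow> e \<in> L) sequentially"
      by (rule eventually_ball_finite[OF S(1)])
    moreover have "eventually (\<lambda>n. n \<ge> m) sequentially"
      by (rule eventually_ge_at_top)
    ultimately have "eventually (\<lambda>n. (\<forall>e\<in>S. e \<in> H (k n) \<longleftrightarrow> e \<in> L) \<and> n \<ge> m) sequentially"
      by (rule eventually_conj)
    then obtain n where n: "\<forall>e\<in>S. e \<in> H (k n) \<longleftrightarrow> e \<in> L" "n \<ge> m"
      using eventually_happens'[OF sequentially_bot] by blast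
    \<comment> \<open>A strictly increasing \<open>k\<close> satisfies \<open>n \<le> k n\<close>,
      so the point \<open>H (k n)\<close> already lies in the larger event
      \<open>A m\<close>.\<close>
    have "m \<le> k n" using n(2) seq_suble[OF k, of n] by simp
    then have "H (k n) \<in> A m" using H[of "k n"] decseqD[OF dec] by blast
    moreover have "L \<in> Univ d" by (auto simp: L_def Univ_def)
    moreover have "L \<inter> S = H (k n) \<inter> S" using n by auto
    ultimately show ?thesis using S(3) AU[of m] by (metis subsetD)
  qed
  then show ?thesis by blast
qed

text \<open>Finite additivity and total mass 1 survive the limit, and Caratheodory's theorem needs
  only continuity at the empty set in addition.\<close>

lemma limit_law:
  fixes Q :: "nat \<Rightarrow> nat set set measure"
  assumes Q: "\<And>n. prob_space (Q n)" "\<And>n. sets (Q n) = B_max d"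
    and lim: "\<And>A. A \<in> B_reg d \<Longrightarrow> (\<lambda>n. measure (Q n) A) \<longlonglongrightarrow> l A"
  obtains P where "prob_space P" "space P = Univ d" "sets P = B_max d"
    "\<And>A. A \<in> B_reg d \<Longrightarrow> measure P A = l A"
proof -
  interpret algebra "Univ d" "B_reg d" by (rule algebra_B_reg)
  have setsQ: "A \<in> sets (Q n)" if "A \<in> B_reg d" for A n
    using that B_reg_subset_B_max Q(2) by blast
  have spQ: "space (Q n) = Univ d" for n
    using Q(2)[of n] sigma_algebra_B_gen[of d "nsets PosNat d"] sets.sigma_algebra_axioms[of "Q n"]
    by (metis B_max_eq_B_gen sets_eq_imp_space_eq sets_sigma_B_gen sigma_algebra.space_measure_of_eq)
  have l0: "0 \<le> l A" if "A \<in> B_reg d" for A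
    by (rule LIMSEQ_le_const[OF lim[OF that]]) auto
  have l_empty: "l {} = 0"
    using LIMSEQ_unique[OF lim[OF empty_sets]] by simp
  have l_Univ: "l (Univ d) = 1"
  proof (rule LIMSEQ_unique[OF lim[OF top]])
    have "measure (Q n) (Univ d) = 1" for n
      using prob_space.prob_space[OF Q(1), of n] spQ by simp
    then show "(\<lambda>n. measure (Q n) (Univ d)) \<longlonglongrightarrow> 1" by simp
  qed
  have l_add: "l (A \<union> B) = l A + l B" if AB: "A \<in> B_reg d" "B \<in> B_reg d" "A \<inter> B = {}" for A B
  proof (rule LIMSEQ_unique[OF lim])
    show "A \<union> B \<in> B_reg d" using AB by auto
    have "measure (Q n) (A \<union> B) = measure (Q n) A + measure (Q n) B" for n
      using AB setsQ prob_space.finite_measure[OF Q(1)]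
      by (intro finite_measure.finite_measure_Union) auto
    then show "(\<lambda>n. measure (Q n) (A \<union> B)) \<longlonglongrightarrow> l A + l B"
      using tendsto_add[OF lim lim] AB by simp
  qed
  have "\<exists>\<mu>. (\<forall>s\<in>B_reg d. \<mu> s = ennreal (l s)) \<and> measure_space (Univ d) (sigma_sets (Univ d) (B_reg d)) \<mu>"
  proof (rule caratheodory_empty_continuous)
    show "positive (B_reg d) (\<lambda>s. ennreal (l s))"
      by (simp add: positive_def l_empty)
    show "additive (B_reg d) (\<lambda>s. ennreal (l s))"
      using l0 l_add by (auto simp: additive_def ennreal_plus[symmetric] simp del: ennreal_plus)
  next
    \<comment> \<open>By compactness a decreasing sequence of regular events with empty intersection
      is eventually empty, so continuity at the empty set holds trivially.\<close>
    fix A assume A: "range A \<subseteq> B_reg d" "decseq A" "(\<Inter>i. A i) = {}"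
    then obtain n where n: "A n = {}" using B_reg_compact by blast
    have "A i = {}" if "i \<ge> n" for i
      using decseqD[OF A(2) that] n by simp
    then have "eventually (\<lambda>i. ennreal (l (A i)) = 0) sequentially"
      unfolding eventually_sequentially by (intro exI[of _ n]) (simp add: l_empty)
    then show "(\<lambda>i. ennreal (l (A i))) \<longlonglongrightarrow> 0"
      by (rule tendsto_eventually)
  qed simp
  then obtain \<mu> where \<mu>: "\<And>s. s \<in> B_reg d \<Longrightarrow> \<mu> s = ennreal (l s)"
    "measure_space (Univ d) (B_max d) \<mu>"
    unfolding sigma_sets_B_reg by blast
  define P where "P = measure_of (Univ d) (B_max d) \<mu>"
  have sa: "sigma_algebra (Univ d) (B_max d)"
    using \<mu>(2) by (simp add: measure_space_def)
  have sp: "space P = Univ d" and se: "sets P = B_max d"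
    unfolding P_def using sa
    by (simp_all add: sigma_algebra.sets_measure_of_eq sigma_algebra.space_measure_of_eq)
  have em: "emeasure P A = ennreal (l A)" if "A \<in> B_reg d" for A
  proof -
    have "emeasure P A = \<mu> A"
      unfolding P_def using sa \<mu>(2) that B_reg_subset_B_max
      by (intro emeasure_measure_of_sigma) (auto simp: measure_space_def)
    then show ?thesis using \<mu>(1) that by simp
  qed
  show thesis
  proof
    show "prob_space P"
      by (rule prob_spaceI) (simp add: sp em[OF top] l_Univ)
    show "measure P A = l A" if "A \<in> B_reg d" for A
      using em[OF that] l0[OF that] by (simp add: measure_def)
  qed fact+
qed

section \<open>Exchangeability\<close>

definition relabel :: "(nat \<Rightarrow> nat) \<Rightarrow> nat set set \<Rightarrow> nat set set" where
  "relabel \<sigma> H = (\<lambda>e. \<sigma> ` e) ` H"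

lemma perm_event_eq_image: "perm_event \<sigma> A = relabel \<sigma> ` A"
  by (simp add: perm_event_def relabel_def[abs_def])

lemma image_in_nsets:
  assumes "\<sigma> permutes PosNat" "e \<in> nsets PosNat d"
  shows "\<sigma> ` e \<in> nsets PosNat d"
proof -
  have "\<sigma> ` e \<subseteq> PosNat"
    using assms(2) permutes_image[OF assms(1)] unfolding nsets_def by blast
  moreover have "card (\<sigma> ` e) = card e"
    using permutes_inj_on[OF assms(1)] by (rule card_image)
  ultimately show ?thesis
    using assms(2) by (simp add: nsets_def)
qed

lemma relabel_in_Univ: "\<sigma> permutes PosNat \<Longrightarrow> H \<in> Univ d \<Longrightarrow> relabel \<sigma> H \<in> Univ d"
  unfolding relabel_def Univ_def using image_in_nsets by blast

lemma relabel_inv: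
  assumes "\<sigma> permutes PosNat"
  shows "relabel \<sigma> (relabel (inv \<sigma>) H) = H" "relabel (inv \<sigma>) (relabel \<sigma> H) = H"
  using permutes_inverses[OF assms] by (simp_all add: relabel_def image_image)

lemma image_mem_relabel:
  assumes "\<sigma> permutes PosNat"
  shows "\<sigma> ` e \<in> relabel \<sigma> H \<longleftrightarrow> e \<in> H"
  unfolding relabel_def using permutes_inj[OF assms] by (auto simp: inj_image_eq_iff)

text \<open>Turns a direct image into a preimage, which commutes with Boolean operations and fits
  measurability and push-forwards.\<close>

lemma perm_event_eq_vimage:
  assumes "\<sigma> permutes PosNat" "A \<subseteq> Univ d"
  shows "perm_event \<sigma> A = {H \<in> Univ d. relabel (inv \<sigma>) H \<in> A}"
proof
  show "perm_event \<sigma> A \<subseteq> {H \<in> Univ d. relabel (inv \<sigma>) H \<in> A}"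
    unfolding perm_event_eq_image using assms(2) relabel_in_Univ[OF assms(1)] relabel_inv[OF assms(1)]
    by auto
  show "{H \<in> Univ d. relabel (inv \<sigma>) H \<in> A} \<subseteq> perm_event \<sigma> A"
    unfolding perm_event_eq_image using relabel_inv(1)[OF assms(1), symmetric] by blast
qed

text \<open>Events with a regular preimage form an algebra, and on edge events the action merely
  moves the edge.\<close>

lemma perm_event_B_reg:
  assumes \<sigma>: "\<sigma> permutes PosNat" and A: "A \<in> B_reg d"
  shows "perm_event \<sigma> A \<in> B_reg d"
proof -
  interpret algebra "Univ d" "B_reg d" by (rule algebra_B_reg)
  let ?v = "\<lambda>A. {H \<in> Univ d. relabel (inv \<sigma>) H \<in> A}"
  let ?C = "{A. A \<subseteq> Univ d \<and> ?v A \<in> B_reg d}"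
  have "?v (Univ d - A) = Univ d - ?v A" if "A \<subseteq> Univ d" for A
    using relabel_in_Univ[OF permutes_inv[OF \<sigma>]] by blast
  moreover have "?v (A \<union> B) = ?v A \<union> ?v B" for A B
    by blast
  ultimately have "algebra (Univ d) ?C"
    unfolding algebra_iff_Un by auto
  moreover have "edge_event d ` nsets PosNat d \<subseteq> ?C"
  proof
    fix X assume "X \<in> edge_event d ` nsets PosNat d"
    then obtain e where e: "e \<in> nsets PosNat d" and X: "X = edge_event d e" by blast
    have XU: "X \<subseteq> Univ d" unfolding X edge_event_def by blast
    have "?v X = edge_event d (\<sigma> ` e)"
      unfolding perm_event_eq_vimage[OF \<sigma> XU, symmetric] unfolding X by (rule perm_event_edge_event[OF \<sigma>])
    then show "X \<in> ?C"
      using XU image_in_nsets[OF \<sigma> e] unfolding B_reg_def by (auto intro: hull_inc)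
  qed
  ultimately have "B_reg d \<subseteq> ?C"
    unfolding B_reg_def by (intro hull_minimal)
  then show ?thesis
    using A perm_event_eq_vimage[OF \<sigma>] by auto
qed

lemma measurable_relabel:
  assumes \<sigma>: "\<sigma> permutes PosNat" and M: "sets M = B_max d"
  shows "relabel \<sigma> \<in> measurable M M"
proof -
  \<comment> \<open>Measurability sees only the sigma-algebra, so \<open>M\<close> may be replaced
    by the zero measure on the same sets, for which checking edge events suffices.\<close>
  let ?N = "measure_of (Univ d) (edge_event d ` nsets PosNat d) (\<lambda>_. 0)"
  have sets: "sets M = sets ?N"
    using edge_event_subset by (simp add: M B_max_def)
  have "relabel \<sigma> \<in> measurable ?N ?N"
  proof (rule measurable_measure_of[OF edge_event_subset])
    show "relabel \<sigma> \<in> space ?N \<rightarrow> Univ d"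
      using relabel_in_Univ[OF \<sigma>] edge_event_subset[of d "nsets PosNat d"] by (simp add: space_measure_of)
    fix X assume "X \<in> edge_event d ` nsets PosNat d"
    then obtain e where e: "e \<in> nsets PosNat d" and X: "X = edge_event d e" by blast
    have XU: "X \<subseteq> Univ d" unfolding X edge_event_def by blast
    have "relabel \<sigma> -` X \<inter> space ?N = perm_event (inv \<sigma>) X"
      unfolding perm_event_eq_vimage[OF permutes_inv[OF \<sigma>] XU] permutes_inv_inv[OF \<sigma>]
      using edge_event_subset[of d "nsets PosNat d"] by (auto simp: space_measure_of)
    also have "\<dots> = edge_event d (inv \<sigma> ` e)"
      unfolding X by (rule perm_event_edge_event[OF permutes_inv[OF \<sigma>]])
    also have "\<dots> \<in> edge_event d ` nsets PosNat d"
      using image_in_nsets[OF permutes_inv[OF \<sigma>] e] by blast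
    finally show "relabel \<sigma> -` X \<inter> space ?N \<in> sets ?N"
      using edge_event_subset[of d "nsets PosNat d"] by (auto intro: sigma_sets.Basic)
  qed
  then show ?thesis
    using measurable_cong_sets[OF sets sets] by simp
qed

section \<open>Exchangeability of the sampled laws\<close>

lemma prob_space_sample_law:
  assumes "finite V" "V \<noteq> {}"
  shows "prob_space (sample_law d V E)"
  unfolding sample_law_def
  by (intro prob_space.prob_space_distr prob_space_PiM prob_space_uniform_count_measure
      sampled_edges_measurable assms)

lemma sets_sample_law: "sets (sample_law d V E) = B_max d"
  by (simp add: sample_law_def B_max_eq_B_gen)

text \<open>Relabelling the sampled edges amounts to permuting the sample. The restriction to
  \<open>PosNat\<close> keeps the permuted sample a point of the product space.\<close>

lemma relabel_sampled_edges:
  assumes "\<sigma> permutes PosNat"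
  shows "relabel (inv \<sigma>) (sampled_edges d E x) = sampled_edges d E (\<lambda>n\<in>PosNat. x (\<sigma> n))"
proof -
  have restr: "(\<lambda>n\<in>PosNat. x (\<sigma> n)) ` e = x ` \<sigma> ` e" if "e \<in> nsets PosNat d" for e
    using that by (auto simp: nsets_def image_image intro!: image_cong)
  have inv: "\<sigma> ` inv \<sigma> ` e = e" "inv \<sigma> ` \<sigma> ` e = e" for e
    using permutes_inverses[OF assms] by (simp_all add: image_image)
  show ?thesis
  proof (rule set_eqI)
    fix e
    have "e \<in> relabel (inv \<sigma>) (sampled_edges d E x) \<longleftrightarrow> \<sigma> ` e \<in> sampled_edges d E x"
      using image_mem_relabel[OF permutes_inv[OF assms], of "\<sigma> ` e"] by (simp add: inv)
    also have "\<dots> \<longleftrightarrow> e \<in> nsets PosNat d \<and> x ` \<sigma> ` e \<in> E"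
      unfolding sampled_edges_def
      using image_in_nsets[OF assms, of e d] image_in_nsets[OF permutes_inv[OF assms], of "\<sigma> ` e" d]
      by (auto simp: inv)
    also have "\<dots> \<longleftrightarrow> e \<in> sampled_edges d E (\<lambda>n\<in>PosNat. x (\<sigma> n))"
      unfolding sampled_edges_def using restr[of e] by auto
    finally show "e \<in> relabel (inv \<sigma>) (sampled_edges d E x) \<longleftrightarrow>
        e \<in> sampled_edges d E (\<lambda>n\<in>PosNat. x (\<sigma> n))" .
  qed
qed

text \<open>The coordinates are i.i.d., so the product measure is unchanged by the reindexing
  \<open>?t\<close>; this invariance is carried through \<open>sampled_edges\<close>.\<close>

lemma sample_law_exchangeable:
  assumes V: "finite V" "V \<noteq> {}" and \<sigma>: "\<sigma> permutes PosNat"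
    and A: "A \<in> B_max d" and \<sigma>A: "perm_event \<sigma> A \<in> B_max d"
  shows "measure (sample_law d V E) (perm_event \<sigma> A) = measure (sample_law d V E) A"
proof -
  let ?M = "PiM PosNat (\<lambda>_. uniform_count_measure V)"
  let ?S = "sampled_edges d E"
  let ?t = "\<lambda>\<omega>. \<lambda>n\<in>PosNat. \<omega> (\<sigma> n)"
  have AU: "A \<subseteq> Univ d"
    using A sigma_sets_into_sp[OF edge_event_subset] unfolding B_max_def by blast
  have S: "?S \<in> measurable ?M (sigma (Univ d) (B_max d))"
    by (rule sampled_edges_measurable[OF V(1)])
  have law: "measure (sample_law d V E) B = measure ?M (?S -` B \<inter> space ?M)" if "B \<in> B_max d" for B
    unfolding sample_law_def using that by (intro measure_distr[OF S]) (simp add: B_max_eq_B_gen)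
  have dt: "distr ?M ?M ?t = ?M"
    using V \<sigma> permutes_in_image[OF \<sigma>] permutes_inj_on[OF \<sigma>]
    by (intro distr_PiM_reindex prob_space_uniform_count_measure) auto
  have t: "?t \<in> measurable ?M ?M"
    using permutes_in_image[OF \<sigma>] by (intro measurable_restrict measurable_component_singleton) auto
  have SU: "?S \<omega> \<in> Univ d" for \<omega>
    by (auto simp: sampled_edges_def Univ_def)
  have "?S -` perm_event \<sigma> A \<inter> space ?M = ?t -` (?S -` A \<inter> space ?M) \<inter> space ?M"
    using measurable_space[OF t]
    unfolding perm_event_eq_vimage[OF \<sigma> AU]
    by (auto simp: relabel_sampled_edges[OF \<sigma>] SU)
  then have "measure (sample_law d V E) (perm_event \<sigma> A)
      = measure ?M (?t -` (?S -` A \<inter> space ?M) \<inter> space ?M)"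
    by (simp only: law[OF \<sigma>A])
  also have "\<dots> = measure (distr ?M ?M ?t) (?S -` A \<inter> space ?M)"
    using A by (intro measure_distr[OF t, symmetric] measurable_sets[OF S]) (simp add: B_max_eq_B_gen)
  also have "\<dots> = measure (sample_law d V E) A"
    by (simp only: dt law[OF A])
  finally show ?thesis .
qed

section \<open>From invariance on regular events to invariant push-forwards\<close>

lemma distr_relabel_vimage:
  assumes P: "space P = Univ d" "sets P = B_max d" and \<sigma>: "\<sigma> permutes PosNat" and A: "A \<in> B_max d"
  shows "emeasure (distr P P (relabel \<sigma>)) A = emeasure P (perm_event (inv \<sigma>) A)"
proof -
  have AU: "A \<subseteq> Univ d"
    using A P sets.sets_into_space by blast
  have "relabel \<sigma> -` A \<inter> space P = perm_event (inv \<sigma>) A"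
    unfolding perm_event_eq_vimage[OF permutes_inv[OF \<sigma>] AU] permutes_inv_inv[OF \<sigma>] P(1) by blast
  then show ?thesis
    using A P(2) by (simp add: emeasure_distr[OF measurable_relabel[OF \<sigma> P(2)]])
qed

text \<open>Regular events are an intersection-stable generator, so two finite measures agreeing on
  them are equal. Equality of push-forwards is the form in which integrals can be
  transported.\<close>

lemma distr_relabel:
  assumes P: "prob_space P" "space P = Univ d" "sets P = B_max d"
    and inv: "\<And>A \<sigma>. A \<in> B_reg d \<Longrightarrow> \<sigma> permutes PosNat \<Longrightarrow> measure P (perm_event \<sigma> A) = measure P A"
    and \<sigma>: "\<sigma> permutes PosNat"
  shows "distr P P (relabel \<sigma>) = P"
proof -
  interpret algebra "Univ d" "B_reg d" by (rule algebra_B_reg)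
  interpret P: prob_space P by fact
  show ?thesis
  proof (rule measure_eqI_generator_eq[where E = "B_reg d" and \<Omega> = "Univ d" and A = "\<lambda>_. Univ d"])
    show "Int_stable (B_reg d)" by (auto simp: Int_stable_def)
    show "B_reg d \<subseteq> Pow (Univ d)" by (rule space_closed)
    show "sets (distr P P (relabel \<sigma>)) = sigma_sets (Univ d) (B_reg d)" "sets P = sigma_sets (Univ d) (B_reg d)"
      by (simp_all add: P sigma_sets_B_reg)
    fix X assume X: "X \<in> B_reg d"
    then show "emeasure (distr P P (relabel \<sigma>)) X = emeasure P X"
      using distr_relabel_vimage[OF P(2,3) \<sigma>, of X] inv[OF X permutes_inv[OF \<sigma>]] B_reg_subset_B_max
      by (auto simp: P.emeasure_eq_measure)
  qed (use P.finite_measure_axioms P.prob_space_axioms measurable_relabel[OF \<sigma> P(3)] in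
      \<open>auto simp: finite_measure.emeasure_finite prob_space.finite_measure P.prob_space_distr\<close>)
qed

section \<open>Relative independence\<close>

locale exchangeable_law = prob_space P for P :: "nat set set measure" +
  fixes d :: nat
  assumes space_P: "space P = Univ d"
    and sets_P: "sets P = B_max d"
    and distr_relabel_P: "\<sigma> permutes PosNat \<Longrightarrow> distr P P (relabel \<sigma>) = P"
begin

lemma relabel_measurable_P: "\<sigma> permutes PosNat \<Longrightarrow> relabel \<sigma> \<in> measurable P P"
  by (rule measurable_relabel[OF _ sets_P])

lemma integrable_relabel:
  fixes f :: "nat set set \<Rightarrow> real"
  assumes "\<sigma> permutes PosNat" "integrable P f"
  shows "integrable P (\<lambda>H. f (relabel \<sigma> H))"
  using integrable_distr[OF relabel_measurable_P[OF assms(1)], of f] assms by (simp add: distr_relabel_P)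

lemma integral_relabel:
  fixes f :: "nat set set \<Rightarrow> real"
  assumes "\<sigma> permutes PosNat" "f \<in> borel_measurable P"
  shows "(\<integral>H. f (relabel \<sigma> H) \<partial>P) = (\<integral>H. f H \<partial>P)"
  using integral_distr[OF relabel_measurable_P[OF assms(1)], of f] assms by (simp add: distr_relabel_P)

text \<open>An L1 substitute for depending on finitely many vertices of \<open>I\<close>. The set
  \<open>F\<close> depends on the tolerance but serves all permutations at once.\<close>

definition almost_fixed :: "nat set \<Rightarrow> (nat set set \<Rightarrow> real) \<Rightarrow> bool" where
  "almost_fixed I f \<longleftrightarrow> (\<forall>\<epsilon>>0. \<exists>F. finite F \<and> F \<subseteq> I \<and>
     (\<forall>\<sigma>. \<sigma> permutes PosNat \<longrightarrow> (\<forall>x\<in>F. \<sigma> x = x) \<longrightarrow> (\<integral>H. \<bar>f (relabel \<sigma> H) - f H\<bar> \<partial>P) < \<epsilon>))"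

lemma almost_fixedD:
  assumes "almost_fixed I f" "\<epsilon> > 0"
  obtains F where "finite F" "F \<subseteq> I"
    "\<And>\<sigma>. \<sigma> permutes PosNat \<Longrightarrow> (\<And>x. x \<in> F \<Longrightarrow> \<sigma> x = x) \<Longrightarrow> (\<integral>H. \<bar>f (relabel \<sigma> H) - f H\<bar> \<partial>P) < \<epsilon>"
  using assms unfolding almost_fixed_def by meson

text \<open>A Lipschitz condition on the increments covers sums, scalar multiples, complements and
  unions of indicators in one statement.\<close>

lemma almost_fixed_comb:
  assumes int: "integrable P f" "integrable P g" "integrable P h"
    and af: "almost_fixed I f" "almost_fixed I g" and c: "0 \<le> c"
    and le: "\<And>H H'. \<bar>h H' - h H\<bar> \<le> c * (\<bar>f H' - f H\<bar> + \<bar>g H' - g H\<bar>)"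
  shows "almost_fixed I h"
  unfolding almost_fixed_def
proof (intro allI impI)
  fix \<epsilon> :: real assume \<epsilon>: "\<epsilon> > 0"
  \<comment> \<open>Dividing by \<open>c + 1\<close> instead of \<open>c\<close> allows
    \<open>c = 0\<close> and makes the final inequality strict.\<close>
  define \<delta> where "\<delta> = \<epsilon> / (2 * (c + 1))"
  have \<delta>: "\<delta> > 0" using \<epsilon> c by (simp add: \<delta>_def)
  obtain F where F: "finite F" "F \<subseteq> I"
    "\<And>\<sigma>. \<sigma> permutes PosNat \<Longrightarrow> (\<And>x. x \<in> F \<Longrightarrow> \<sigma> x = x) \<Longrightarrow> (\<integral>H. \<bar>f (relabel \<sigma> H) - f H\<bar> \<partial>P) < \<delta>"
    using almost_fixedD[OF af(1) \<delta>] by metis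
  obtain G where G: "finite G" "G \<subseteq> I"
    "\<And>\<sigma>. \<sigma> permutes PosNat \<Longrightarrow> (\<And>x. x \<in> G \<Longrightarrow> \<sigma> x = x) \<Longrightarrow> (\<integral>H. \<bar>g (relabel \<sigma> H) - g H\<bar> \<partial>P) < \<delta>"
    using almost_fixedD[OF af(2) \<delta>] by metis
  show "\<exists>F. finite F \<and> F \<subseteq> I \<and>
     (\<forall>\<sigma>. \<sigma> permutes PosNat \<longrightarrow> (\<forall>x\<in>F. \<sigma> x = x) \<longrightarrow> (\<integral>H. \<bar>h (relabel \<sigma> H) - h H\<bar> \<partial>P) < \<epsilon>)"
  proof (intro exI[of _ "F \<union> G"] conjI allI impI)
    fix \<sigma> assume \<sigma>: "\<sigma> permutes PosNat" and fixd: "\<forall>x\<in>F \<union> G. \<sigma> x = x"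
    have "(\<integral>H. \<bar>h (relabel \<sigma> H) - h H\<bar> \<partial>P)
        \<le> (\<integral>H. c * (\<bar>f (relabel \<sigma> H) - f H\<bar> + \<bar>g (relabel \<sigma> H) - g H\<bar>) \<partial>P)"
      using int integrable_relabel[OF \<sigma>] le by (intro integral_mono) auto
    also have "\<dots> = c * ((\<integral>H. \<bar>f (relabel \<sigma> H) - f H\<bar> \<partial>P) + (\<integral>H. \<bar>g (relabel \<sigma> H) - g H\<bar> \<partial>P))"
      using int integrable_relabel[OF \<sigma>] by simp
    also have "\<dots> \<le> c * (\<delta> + \<delta>)"
      using F(3)[OF \<sigma>] G(3)[OF \<sigma>] fixd c by (intro mult_left_mono add_mono) (auto intro: less_imp_le)
    also have "\<dots> < \<epsilon>"
    proof -
      have "\<epsilon> = 2 * (c + 1) * \<delta>" using c by (simp add: \<delta>_def)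
      then show ?thesis using \<delta> by (simp add: algebra_simps)
    qed
    finally show "(\<integral>H. \<bar>h (relabel \<sigma> H) - h H\<bar> \<partial>P) < \<epsilon>" .
  qed (use F G in auto)
qed

text \<open>Dominated convergence gives an approximation \<open>s i\<close> close to
  \<open>f\<close> in L1; the rest is a three-term triangle inequality.\<close>

lemma almost_fixed_lim:
  assumes int: "\<And>i. integrable P (s i)" "integrable P f" "integrable P w"
    and af: "\<And>i. almost_fixed I (s i)"
    and lim: "\<And>H. H \<in> Univ d \<Longrightarrow> (\<lambda>i::nat. s i H) \<longlonglongrightarrow> f H"
    and dom: "\<And>i H. H \<in> Univ d \<Longrightarrow> \<bar>s i H\<bar> \<le> w H"
  shows "almost_fixed I f"
  unfolding almost_fixed_def
proof (intro allI impI)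
  fix \<epsilon> :: real assume \<epsilon>: "\<epsilon> > 0"
  have "(\<lambda>i. \<integral>H. \<bar>s i H - f H\<bar> \<partial>P) \<longlonglongrightarrow> (\<integral>H. 0 \<partial>P)"
  proof (rule integral_dominated_convergence)
    show "integrable P (\<lambda>H. w H + \<bar>f H\<bar>)" using int by auto
    show "AE H in P. (\<lambda>i. \<bar>s i H - f H\<bar>) \<longlonglongrightarrow> 0"
    proof (rule AE_I2)
      fix H assume "H \<in> space P"
      then show "(\<lambda>i. \<bar>s i H - f H\<bar>) \<longlonglongrightarrow> 0"
        using lim[of H] space_P by (auto intro: tendsto_rabs_zero simp: LIM_zero_iff)
    qed
    show "AE H in P. norm \<bar>s i H - f H\<bar> \<le> w H + \<bar>f H\<bar>" for i
    proof (rule AE_I2)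
      fix H assume "H \<in> space P"
      then show "norm \<bar>s i H - f H\<bar> \<le> w H + \<bar>f H\<bar>"
        using dom[of H i] space_P by auto
    qed
  qed (use int in auto)
  then have "(\<lambda>i. \<integral>H. \<bar>s i H - f H\<bar> \<partial>P) \<longlonglongrightarrow> 0" by simp
  then have "eventually (\<lambda>i. (\<integral>H. \<bar>s i H - f H\<bar> \<partial>P) < \<epsilon> / 3) sequentially"
    using \<epsilon> by (intro order_tendstoD(2)) auto
  then obtain i where i: "(\<integral>H. \<bar>s i H - f H\<bar> \<partial>P) < \<epsilon> / 3"
    using eventually_happens'[OF sequentially_bot] by blast
  have \<epsilon>3: "\<epsilon> / 3 > 0" using \<epsilon> by simp
  obtain F where F: "finite F" "F \<subseteq> I"
    "\<And>\<sigma>. \<sigma> permutes PosNat \<Longrightarrow> (\<And>x. x \<in> F \<Longrightarrow> \<sigma> x = x) \<Longrightarrow> (\<integral>H. \<bar>s i (relabel \<sigma> H) - s i H\<bar> \<partial>P) < \<epsilon> / 3"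
    using almost_fixedD[OF af[of i] \<epsilon>3] by metis
  show "\<exists>F. finite F \<and> F \<subseteq> I \<and>
     (\<forall>\<sigma>. \<sigma> permutes PosNat \<longrightarrow> (\<forall>x\<in>F. \<sigma> x = x) \<longrightarrow> (\<integral>H. \<bar>f (relabel \<sigma> H) - f H\<bar> \<partial>P) < \<epsilon>)"
  proof (intro exI[of _ F] conjI allI impI)
    fix \<sigma> assume \<sigma>: "\<sigma> permutes PosNat" and fixd: "\<forall>x\<in>F. \<sigma> x = x"
    \<comment> \<open>Invariance of \<open>P\<close> makes the approximation error the same before
      and after relabelling.\<close>
    have eq: "(\<integral>H. \<bar>s i (relabel \<sigma> H) - f (relabel \<sigma> H)\<bar> \<partial>P) = (\<integral>H. \<bar>s i H - f H\<bar> \<partial>P)"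
      using int by (intro integral_relabel[OF \<sigma>, of "\<lambda>H. \<bar>s i H - f H\<bar>"]) auto
    have "(\<integral>H. \<bar>f (relabel \<sigma> H) - f H\<bar> \<partial>P)
        \<le> (\<integral>H. \<bar>s i (relabel \<sigma> H) - f (relabel \<sigma> H)\<bar> + \<bar>s i (relabel \<sigma> H) - s i H\<bar> + \<bar>s i H - f H\<bar> \<partial>P)"
      using int integrable_relabel[OF \<sigma>] by (intro integral_mono) auto
    also have "\<dots> = (\<integral>H. \<bar>s i (relabel \<sigma> H) - f (relabel \<sigma> H)\<bar> \<partial>P)
        + (\<integral>H. \<bar>s i (relabel \<sigma> H) - s i H\<bar> \<partial>P) + (\<integral>H. \<bar>s i H - f H\<bar> \<partial>P)"
      using int integrable_relabel[OF \<sigma>] by simp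
    also have "\<dots> < \<epsilon>"
      using i F(3)[OF \<sigma>] fixd unfolding eq by auto
    finally show "(\<integral>H. \<bar>f (relabel \<sigma> H) - f H\<bar> \<partial>P) < \<epsilon>" .
  qed (use F in auto)
qed

lemma B_sub_subset_sets_P: "I \<subseteq> PosNat \<Longrightarrow> B_sub d I \<subseteq> sets P"
  unfolding sets_P B_sub_eq_B_gen B_max_eq_B_gen by (intro B_gen_mono) (auto simp: nsets_def)

lemma integrable_indicator_P: "A \<in> sets P \<Longrightarrow> integrable P (indicator A :: _ \<Rightarrow> real)"
  by (simp add: integrable_indicator_iff less_top[symmetric])

text \<open>The finite set is \<open>e\<close> itself: a permutation fixing its vertices does not
  change whether \<open>e\<close> is present.\<close>

lemma almost_fixed_edge_event:
  assumes e: "e \<in> nsets I d"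
  shows "almost_fixed I (indicator (edge_event d e))"
  unfolding almost_fixed_def
proof (intro allI impI exI[of _ e] conjI)
  fix \<epsilon> :: real and \<sigma> assume \<epsilon>: "\<epsilon> > 0" and \<sigma>: "\<sigma> permutes PosNat" and fixd: "\<forall>x\<in>e. \<sigma> x = x"
  have "\<sigma> ` e = e" using fixd by auto
  then have "e \<in> relabel \<sigma> H \<longleftrightarrow> e \<in> H" for H
    using image_mem_relabel[OF \<sigma>, of e H] by simp
  then have "indicator (edge_event d e) (relabel \<sigma> H) = (indicator (edge_event d e) H :: real)" if "H \<in> space P" for H
    using that relabel_in_Univ[OF \<sigma>] by (simp add: edge_event_def indicator_def space_P)
  then have "(\<integral>H. \<bar>indicator (edge_event d e) (relabel \<sigma> H) - indicator (edge_event d e) H\<bar> \<partial>P) = (\<integral>H. (0::real) \<partial>P)"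
    by (intro Bochner_Integration.integral_cong) auto
  then show "(\<integral>H. \<bar>indicator (edge_event d e) (relabel \<sigma> H) - indicator (edge_event d e) H\<bar> \<partial>P) < \<epsilon>"
    using \<epsilon> by simp
qed (use e in \<open>auto simp: nsets_def\<close>)

lemma almost_fixed_cong:
  assumes "almost_fixed I f" "\<And>H. H \<in> Univ d \<Longrightarrow> f H = g H"
  shows "almost_fixed I g"
proof -
  have "(\<integral>H. \<bar>f (relabel \<sigma> H) - f H\<bar> \<partial>P) = (\<integral>H. \<bar>g (relabel \<sigma> H) - g H\<bar> \<partial>P)"
    if "\<sigma> permutes PosNat" for \<sigma>
    using assms(2) relabel_in_Univ[OF that] by (intro Bochner_Integration.integral_cong) (auto simp: space_P)
  then show ?thesis
    using assms(1) unfolding almost_fixed_def by metis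
qed

lemma almost_fixed_const: "almost_fixed I (\<lambda>_. c)"
  unfolding almost_fixed_def by (auto intro: exI[of _ "{}"])

lemma almost_fixed_indicator:
  assumes I: "I \<subseteq> PosNat" and A: "A \<in> B_sub d I"
  shows "almost_fixed I (indicator A)"
  using A unfolding B_sub_def
proof (induction rule: sigma_sets.induct)
  case (Basic a)
  then show ?case using almost_fixed_edge_event by blast
next
  case Empty
  have "(indicator {} :: nat set set \<Rightarrow> real) = (\<lambda>_. 0)" by auto
  then show ?case using almost_fixed_const by simp
next
  case (Compl a)
  then have "a \<in> sets P" using B_sub_subset_sets_P[OF I] unfolding B_sub_def by blast
  then have "almost_fixed I (\<lambda>H. 1 - indicator a H)"
    using Compl.IH integrable_indicator_P
    \<comment> \<open>The combination lemma takes two functions; the same indicator fills both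
      places.\<close>
    by (intro almost_fixed_comb[where f = "indicator a" and g = "indicator a" and c = 1, OF _ _ _ Compl.IH Compl.IH])
       (auto split: split_indicator)
  then show ?case
    by (rule almost_fixed_cong) (auto simp: indicator_def)
next
  case (Union a)
  have a: "a i \<in> sets P" for i
    using Union.hyps[of i] B_sub_subset_sets_P[OF I] unfolding B_sub_def by (rule subsetD[rotated])
  \<comment> \<open>A countable union is the pointwise limit of its finite partial unions, which
    need their own induction.\<close>
  have fin: "almost_fixed I (indicator (\<Union>i<n. a i))" for n :: nat
  proof (induction n)
    case 0
    have "(indicator {} :: nat set set \<Rightarrow> real) = (\<lambda>_. 0)" by auto
    then show ?case using almost_fixed_const by simp
  next
    case (Suc n)
    show ?case
      using a
      by (intro almost_fixed_comb[OF _ _ _ Suc Union.IH[of n], where c = 1])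
         (auto intro!: integrable_indicator_P simp: lessThan_Suc split: split_indicator)
  qed
  show ?case
  proof (rule almost_fixed_lim[where w = "\<lambda>_. 1"])
    show "(\<lambda>n. indicator (\<Union>i<n. a i) H :: real) \<longlonglongrightarrow> indicator (\<Union>i. a i) H" for H
      by (rule LIMSEQ_indicator_UN)
  qed (use fin a in \<open>auto intro!: integrable_indicator_P split: split_indicator\<close>)
qed

lemma subalgebra_B_gen:
  assumes "\<E> \<subseteq> nsets PosNat d"
  shows "subalgebra P (sigma (Univ d) (B_gen d \<E>))"
  unfolding subalgebra_def sets_sigma_B_gen
  using B_gen_mono[OF assms] sigma_algebra.space_measure_of_eq[OF sigma_algebra_B_gen]
  by (simp add: space_P sets_P B_max_eq_B_gen)

lemma almost_fixed_measurable:
  assumes I: "I \<subseteq> PosNat" and f: "f \<in> borel_measurable (sigma (Univ d) (B_sub d I))" "integrable P f"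
  shows "almost_fixed I f"
proof -
  let ?F = "sigma (Univ d) (B_sub d I)"
  \<comment> \<open>Inducting over integrable functions on the restricted measure ensures that the
    indicators of the base case belong to sets of \<open>B_sub d I\<close>.\<close>
  let ?R = "restr_to_subalg P ?F"
  have sub: "subalgebra P ?F"
    unfolding B_sub_eq_B_gen using I by (intro subalgebra_B_gen) (auto simp: nsets_def)
  have sets_R: "sets ?R = B_sub d I"
    using sets_restr_to_subalg[OF sub] by (simp add: B_sub_eq_B_gen)
  have int: "integrable P g" if "integrable ?R g" for g :: "nat set set \<Rightarrow> real"
    by (rule integrable_from_subalg[OF sub that])
  have "integrable ?R f"
    by (rule integrable_in_subalg[OF sub f])
  then show ?thesis
  proof (induction rule: integrable_induct)
    case (base A c)
    then have A: "A \<in> B_sub d I"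
      by (simp only: sets_R)
    then have "integrable P (indicator A :: _ \<Rightarrow> real)"
      using B_sub_subset_sets_P[OF I] integrable_indicator_P by blast
    then show ?case
      by (intro almost_fixed_comb[OF _ _ _ almost_fixed_indicator[OF I A] almost_fixed_indicator[OF I A],
            where c = "\<bar>c\<bar>"])
         (auto split: split_indicator)
  next
    case (add f g)
    then show ?case
      using int by (intro almost_fixed_comb[OF _ _ _ add.IH, where c = 1]) auto
  next
    case (lim f s)
    then show ?case
      \<comment> \<open>The factor 2 is the bound on the approximating functions supplied by
        \<open>integrable_induct\<close>.\<close>
      using int by (intro almost_fixed_lim[OF _ _ _ lim.IH, where w = "\<lambda>H. 2 * norm (f H)"])
        (auto simp: space_restr_to_subalg space_P)
  qed
qed

text \<open>The invariant substitution by \<open>relabel \<sigma>\<close> turns the integral of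
  \<open>f\<close> over \<open>C'\<close> into one over \<open>C\<close> of the relabelled
  \<open>f\<close>, leaving only the L1 change of \<open>f\<close>.\<close>

lemma almost_fixed_integral:
  fixes f :: "nat set set \<Rightarrow> real"
  assumes int: "integrable P f" and C: "C \<in> sets P" and C': "C' \<in> sets P" and \<sigma>: "\<sigma> permutes PosNat"
    and CC': "\<And>H. H \<in> Univ d \<Longrightarrow> relabel \<sigma> H \<in> C' \<longleftrightarrow> H \<in> C"
  shows "\<bar>(\<integral>H. indicator C' H * f H \<partial>P) - (\<integral>H. indicator C H * f H \<partial>P)\<bar> \<le> (\<integral>H. \<bar>f (relabel \<sigma> H) - f H\<bar> \<partial>P)"
proof -
  have intf: "integrable P (\<lambda>H. indicator C H * f (relabel \<sigma> H))" "integrable P (\<lambda>H. indicator C H * f H)"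
    using integrable_mult_indicator[OF C integrable_relabel[OF \<sigma> int]] integrable_mult_indicator[OF C int]
    by simp_all
  have "(\<integral>H. indicator C' H * f H \<partial>P) = (\<integral>H. indicator C' (relabel \<sigma> H) * f (relabel \<sigma> H) \<partial>P)"
    using int C' by (intro integral_relabel[OF \<sigma>, of "\<lambda>H. indicator C' H * f H", symmetric]) auto
  also have "\<dots> = (\<integral>H. indicator C H * f (relabel \<sigma> H) \<partial>P)"
    using CC' by (intro Bochner_Integration.integral_cong) (auto simp: space_P indicator_def)
  finally have "(\<integral>H. indicator C' H * f H \<partial>P) - (\<integral>H. indicator C H * f H \<partial>P)
      = (\<integral>H. indicator C H * f (relabel \<sigma> H) - indicator C H * f H \<partial>P)"
    using intf by simp
  then have "\<bar>(\<integral>H. indicator C' H * f H \<partial>P) - (\<integral>H. indicator C H * f H \<partial>P)\<bar>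
      \<le> (\<integral>H. \<bar>indicator C H * f (relabel \<sigma> H) - indicator C H * f H\<bar> \<partial>P)"
    by (simp only: integral_abs_bound)
  also have "\<dots> \<le> (\<integral>H. \<bar>f (relabel \<sigma> H) - f H\<bar> \<partial>P)"
    using int intf integrable_relabel[OF \<sigma> int] by (intro integral_mono) (auto simp: indicator_def)
  finally show ?thesis .
qed

end

section \<open>Moving vertices, and events prescribing finitely many edges\<close>

text \<open>Exchanges \<open>D\<close> with an equally large fresh subset \<open>T\<close> of the
  infinite set \<open>Z\<close>.\<close>

lemma exists_moving_permutation:
  fixes D :: "nat set"
  assumes D: "finite D" "D \<subseteq> PosNat" and Z: "infinite Z" "Z \<subseteq> PosNat" and N: "finite N"
    and ND: "N \<inter> D = {}"
  obtains \<sigma> where "\<sigma> permutes PosNat" "\<And>x. x \<in> D \<Longrightarrow> \<sigma> x \<in> Z" "\<And>x. x \<in> N \<Longrightarrow> \<sigma> x = x"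
proof -
  \<comment> \<open>Avoiding \<open>D\<close> makes the exchange an involution, and avoiding
    \<open>N\<close> leaves \<open>N\<close> fixed.\<close>
  have "infinite (Z - (N \<union> D))" using Z(1) N D(1) by (simp add: Diff_infinite_finite)
  then obtain T where T: "T \<subseteq> Z - (N \<union> D)" "finite T" "card T = card D"
    by (meson infinite_arbitrarily_large)
  obtain g where g: "bij_betw g D T"
    using finite_same_card_bij[OF D(1) T(2)] T(3) by metis
  define \<sigma> where "\<sigma> x = (if x \<in> D then g x else if x \<in> T then inv_into D g x else x)" for x
  have gT: "g x \<in> T" "g x \<notin> D" if "x \<in> D" for x
    using that g T(1) bij_betwE by fastforce+
  have iD: "inv_into D g x \<in> D" "g (inv_into D g x) = x" if "x \<in> T" for x
    using that bij_betw_inv_into_right[OF g] bij_betwE[OF bij_betw_inv_into[OF g]] by auto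
  have inv: "\<sigma> (\<sigma> x) = x" for x
    unfolding \<sigma>_def using gT iD T(1) bij_betw_inv_into_left[OF g] by auto
  have "bij \<sigma>"
    by (rule o_bij[of \<sigma>]) (auto simp: inv fun_eq_iff)
  moreover have "\<sigma> x = x" if "x \<notin> PosNat" for x
  proof -
    have "x \<notin> D" "x \<notin> T" using that D(2) T(1) Z(2) by blast+
    then show ?thesis by (simp add: \<sigma>_def)
  qed
  ultimately have "\<sigma> permutes PosNat"
    by (auto simp: permutes_def bij_iff)
  moreover have "\<sigma> x \<in> Z" if "x \<in> D" for x
    using that gT T(1) unfolding \<sigma>_def by auto
  moreover have "\<sigma> x = x" if "x \<in> N" for x
    using that ND T(1) unfolding \<sigma>_def by auto
  ultimately show thesis using that by blast
qed

text \<open>Only presence of edges is prescribed, never absence. Such events are the finite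
  intersections of edge events, hence an intersection-stable generator of
  \<open>B_gen\<close>.\<close>

definition containing :: "nat \<Rightarrow> nat set set \<Rightarrow> nat set set set" where
  "containing d \<F> = {H \<in> Univ d. \<F> \<subseteq> H}"

lemma containing_in_B_gen:
  assumes "finite \<F>" "\<F> \<subseteq> \<E>"
  shows "containing d \<F> \<in> B_gen d \<E>"
  using assms
proof (induction \<F> rule: finite_induct)
  case empty
  have "containing d {} = Univ d" by (auto simp: containing_def)
  then show ?case by (simp add: B_gen_def sigma_sets_top)
next
  case (insert e \<F>)
  interpret sigma_algebra "Univ d" "B_gen d \<E>" by (rule sigma_algebra_B_gen)
  have "containing d (insert e \<F>) = edge_event d e \<inter> containing d \<F>"
    by (auto simp: containing_def edge_event_def)
  moreover have "edge_event d e \<in> B_gen d \<E>"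
    using insert.prems by (auto simp: B_gen_def intro: sigma_sets.Basic)
  ultimately show ?case
    using insert by auto
qed

lemma B_gen_eq_sigma_sets_containing:
  "B_gen d \<E> = sigma_sets (Univ d) (containing d ` {\<F>. finite \<F> \<and> \<F> \<subseteq> \<E>})"
proof (rule antisym)
  have "edge_event d e = containing d {e}" for e
    by (auto simp: containing_def edge_event_def)
  then show "B_gen d \<E> \<subseteq> sigma_sets (Univ d) (containing d ` {\<F>. finite \<F> \<and> \<F> \<subseteq> \<E>})"
    unfolding B_gen_def by (intro sigma_sets_mono') auto
  have "containing d ` {\<F>. finite \<F> \<and> \<F> \<subseteq> \<E>} \<subseteq> B_gen d \<E>"
    using containing_in_B_gen by blast
  then show "sigma_sets (Univ d) (containing d ` {\<F>. finite \<F> \<and> \<F> \<subseteq> \<E>}) \<subseteq> B_gen d \<E>"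
    unfolding B_gen_def by (rule sigma_sets_mono)
qed

lemma Int_stable_containing: "Int_stable (containing d ` {\<F>. finite \<F> \<and> \<F> \<subseteq> \<E>})"
proof (rule Int_stableI_image)
  fix \<F> \<G> assume "\<F> \<in> {\<F>. finite \<F> \<and> \<F> \<subseteq> \<E>}" "\<G> \<in> {\<F>. finite \<F> \<and> \<F> \<subseteq> \<E>}"
  moreover have "containing d \<F> \<inter> containing d \<G> = containing d (\<F> \<union> \<G>)"
    by (auto simp: containing_def)
  ultimately show "\<exists>k\<in>{\<F>. finite \<F> \<and> \<F> \<subseteq> \<E>}. containing d \<F> \<inter> containing d \<G> = containing d k"
    by (intro bexI[of _ "\<F> \<union> \<G>"]) auto
qed

lemma Un_nsets_subset: "(\<And>i. i \<in> K \<Longrightarrow> J i \<subseteq> L) \<Longrightarrow> (\<Union>i\<in>K. nsets (J i) d) \<subseteq> nsets L d"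
  unfolding nsets_def by blast

section \<open>Conditional expectations under exchangeability\<close>

context exchangeable_law
begin

lemma finite_measure_subalgebra_B_gen:
  "\<E> \<subseteq> nsets PosNat d \<Longrightarrow> finite_measure_subalgebra P (sigma (Univ d) (B_gen d \<E>))"
  by (intro finite_measure_subalgebra.intro finite_measure_subalgebra_axioms.intro
      finite_measure_axioms subalgebra_B_gen)

text \<open>The defining property of \<open>h\<close> is known only on the small sigma-algebra.
  Relabelling carries it from an event there to an arbitrary prescription of edges inside the
  \<open>J i\<close>, with arbitrarily small error.\<close>

lemma set_integral_containing:
  assumes I: "I \<subseteq> PosNat" and J: "\<And>i. i \<in> K \<Longrightarrow> J i \<subseteq> PosNat"
    and inf: "infinite (I \<inter> (\<Inter>i\<in>K. J i))"
    and f: "f \<in> borel_measurable (sigma (Univ d) (B_sub d I))" "integrable P f"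
    and \<F>: "finite \<F>" "\<F> \<subseteq> (\<Union>i\<in>K. nsets (J i) d)"
  defines "h \<equiv> real_cond_exp P (sigma (Univ d) (B_gen d (\<Union>i\<in>K. nsets (I \<inter> J i) d))) f"
  shows "(\<integral>H. indicator (containing d \<F>) H * f H \<partial>P) = (\<integral>H. indicator (containing d \<F>) H * h H \<partial>P)"
proof -
  let ?\<E> = "\<Union>i\<in>K. nsets (I \<inter> J i) d"
  let ?H = "sigma (Univ d) (B_gen d ?\<E>)"
  have \<E>: "?\<E> \<subseteq> nsets PosNat d" using I by (intro Un_nsets_subset) auto
  have \<F>P: "\<F> \<subseteq> nsets PosNat d" using \<F>(2) Un_nsets_subset[of K J PosNat d] J by blast
  interpret H: finite_measure_subalgebra P ?H
    using finite_measure_subalgebra_B_gen[OF \<E>] .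
  have sets_P': "B_gen d (nsets PosNat d) = sets P" by (simp add: sets_P B_max_eq_B_gen)
  have h_int: "integrable P h"
    unfolding h_def using f(2) by (rule H.real_cond_exp_int(1))
  have "subalgebra (sigma (Univ d) (B_sub d I)) ?H"
    unfolding subalgebra_def B_sub_eq_B_gen sets_sigma_B_gen
    using B_gen_mono[OF Un_nsets_subset[of K "\<lambda>i. I \<inter> J i" I d], of d]
    by (simp add: sigma_algebra.space_measure_of_eq[OF sigma_algebra_B_gen])
  \<comment> \<open>Edges inside \<open>I \<inter> J i\<close> lie in \<open>I\<close>, so
    \<open>h\<close> is almost fixed with a finite subset of \<open>I\<close>, just like
    \<open>f\<close>.\<close>
  then have h_meas: "h \<in> borel_measurable (sigma (Univ d) (B_sub d I))"
    unfolding h_def by (rule measurable_from_subalg) simp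
  \<comment> \<open>The summand 0 gives the shape expected by
    \<open>field_le_epsilon\<close>.\<close>
  have "\<bar>(\<integral>H. indicator (containing d \<F>) H * f H \<partial>P) - (\<integral>H. indicator (containing d \<F>) H * h H \<partial>P)\<bar> \<le> 0 + \<epsilon>"
    if \<epsilon>: "\<epsilon> > 0" for \<epsilon>
  proof -
    have \<epsilon>2: "\<epsilon> / 2 > 0" using \<epsilon> by simp
    obtain A where A: "finite A" "A \<subseteq> I"
      "\<And>\<sigma>. \<sigma> permutes PosNat \<Longrightarrow> (\<And>x. x \<in> A \<Longrightarrow> \<sigma> x = x) \<Longrightarrow> (\<integral>H. \<bar>f (relabel \<sigma> H) - f H\<bar> \<partial>P) < \<epsilon> / 2"
      using almost_fixedD[OF almost_fixed_measurable[OF I f] \<epsilon>2] by metis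
    obtain B where B: "finite B" "B \<subseteq> I"
      "\<And>\<sigma>. \<sigma> permutes PosNat \<Longrightarrow> (\<And>x. x \<in> B \<Longrightarrow> \<sigma> x = x) \<Longrightarrow> (\<integral>H. \<bar>h (relabel \<sigma> H) - h H\<bar> \<partial>P) < \<epsilon> / 2"
      using almost_fixedD[OF almost_fixed_measurable[OF I h_meas h_int] \<epsilon>2] by metis
    let ?S = "\<Union>\<F>"
    have S: "finite ?S" "?S \<subseteq> PosNat"
      using \<F>(1) \<F>P by (auto simp: nsets_def)
    \<comment> \<open>The vertices to be fixed all lie in \<open>I\<close> and those to be moved lie
      outside it, so the demands are compatible.\<close>
    obtain \<sigma> where \<sigma>: "\<sigma> permutes PosNat"
      and move: "\<And>x. x \<in> ?S - I \<Longrightarrow> \<sigma> x \<in> I \<inter> (\<Inter>i\<in>K. J i)"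
      and stay: "\<And>x. x \<in> A \<union> B \<union> (?S \<inter> I) \<Longrightarrow> \<sigma> x = x"
    proof (rule exists_moving_permutation[of "?S - I" "I \<inter> (\<Inter>i\<in>K. J i)" "A \<union> B \<union> (?S \<inter> I)"])
      show "(A \<union> B \<union> (?S \<inter> I)) \<inter> (?S - I) = {}" using A(2) B(2) by blast
      show "I \<inter> (\<Inter>i\<in>K. J i) \<subseteq> PosNat" using I by blast
      show "?S - I \<subseteq> PosNat" using S(2) by blast
      show "finite (?S - I)" "finite (A \<union> B \<union> (?S \<inter> I))" using S(1) A(1) B(1) by auto
    qed (use inf in auto)
    let ?\<F>' = "(\<lambda>e. \<sigma> ` e) ` \<F>"
    have \<F>': "?\<F>' \<subseteq> ?\<E>"
    proof
      fix e' assume "e' \<in> ?\<F>'"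
      then obtain e where e: "e \<in> \<F>" and e': "e' = \<sigma> ` e" by blast
      obtain i where i: "i \<in> K" "e \<in> nsets (J i) d" using e \<F>(2) by blast
      \<comment> \<open>A vertex in \<open>I\<close> stays and was already in \<open>J i\<close>;
        any other vertex lands in the common part of all the sets.\<close>
      have "\<sigma> x \<in> I \<inter> J i" if "x \<in> e" for x
      proof (cases "x \<in> I")
        case True
        then have "\<sigma> x = x" using stay e that by blast
        then show ?thesis using True i that by (auto simp: nsets_def)
      next
        case False
        then have "\<sigma> x \<in> I \<inter> (\<Inter>i\<in>K. J i)" using move e that by blast
        then show ?thesis using i(1) by blast
      qed
      moreover have "e' \<in> nsets PosNat d"
        unfolding e' using e \<F>P by (intro image_in_nsets[OF \<sigma>]) blast
      ultimately have "e' \<in> nsets (I \<inter> J i) d"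
        unfolding e' nsets_def by blast
      then show "e' \<in> ?\<E>" using i(1) by blast
    qed
    let ?C = "containing d \<F>" and ?C' = "containing d ?\<F>'"
    have C'H: "?C' \<in> B_gen d ?\<E>"
      using \<F>(1) \<F>' by (intro containing_in_B_gen) auto
    have C'P: "?C' \<in> sets P" using C'H B_gen_mono[OF \<E>, of d] sets_P' by blast
    have CP: "?C \<in> sets P" using containing_in_B_gen[OF \<F>(1) \<F>P, of d] sets_P' by blast
    have CC': "relabel \<sigma> H \<in> ?C' \<longleftrightarrow> H \<in> ?C" if "H \<in> Univ d" for H
      using that relabel_in_Univ[OF \<sigma> that] image_mem_relabel[OF \<sigma>, of _ H]
      by (auto simp: containing_def)
    have "(\<integral>H. indicator ?C' H * f H \<partial>P) = (\<integral>H. indicator ?C' H * h H \<partial>P)"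
      using H.real_cond_exp_intA[OF f(2), of ?C'] C'H
      unfolding h_def set_lebesgue_integral_def by simp
    moreover have "\<bar>(\<integral>H. indicator ?C' H * f H \<partial>P) - (\<integral>H. indicator ?C H * f H \<partial>P)\<bar> < \<epsilon> / 2"
      using almost_fixed_integral[OF f(2) CP C'P \<sigma> CC'] A(3)[OF \<sigma>] stay by fastforce
    moreover have "\<bar>(\<integral>H. indicator ?C' H * h H \<partial>P) - (\<integral>H. indicator ?C H * h H \<partial>P)\<bar> < \<epsilon> / 2"
      using almost_fixed_integral[OF h_int CP C'P \<sigma> CC'] B(3)[OF \<sigma>] stay by fastforce
    ultimately show ?thesis by linarith
  qed
  then have "\<bar>(\<integral>H. indicator (containing d \<F>) H * f H \<partial>P) - (\<integral>H. indicator (containing d \<F>) H * h H \<partial>P)\<bar> \<le> 0"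
    by (rule field_le_epsilon)
  then show ?thesis by simp
qed

text \<open>The integral identity extends from the generating \<open>containing\<close> events to
  the whole join by a Dynkin argument; uniqueness of conditional expectations then applies.\<close>

lemma real_cond_exp_B_gen_eq:
  assumes I: "I \<subseteq> PosNat" and J: "\<And>i. i \<in> K \<Longrightarrow> J i \<subseteq> PosNat"
    and inf: "infinite (I \<inter> (\<Inter>i\<in>K. J i))"
    and f: "f \<in> borel_measurable (sigma (Univ d) (B_sub d I))" "integrable P f"
  shows "AE H in P. real_cond_exp P (sigma (Univ d) (B_gen d (\<Union>i\<in>K. nsets (J i) d))) f H
    = real_cond_exp P (sigma (Univ d) (B_gen d (\<Union>i\<in>K. nsets (I \<inter> J i) d))) f H"
proof -
  let ?\<E> = "\<Union>i\<in>K. nsets (J i) d" and ?\<E>' = "\<Union>i\<in>K. nsets (I \<inter> J i) d"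
  let ?G = "sigma (Univ d) (B_gen d ?\<E>)" and ?H = "sigma (Univ d) (B_gen d ?\<E>')"
  let ?h = "real_cond_exp P ?H f"
  have \<E>: "?\<E> \<subseteq> nsets PosNat d" "?\<E>' \<subseteq> nsets PosNat d"
    using I J by (auto intro!: Un_nsets_subset)
  have \<E>\<E>': "?\<E>' \<subseteq> ?\<E>" by (auto simp: nsets_def)
  interpret G: finite_measure_subalgebra P ?G
    using finite_measure_subalgebra_B_gen[OF \<E>(1)] .
  interpret H: finite_measure_subalgebra P ?H
    using finite_measure_subalgebra_B_gen[OF \<E>(2)] .
  have GP: "B_gen d ?\<E> \<subseteq> sets P"
    using B_gen_mono[OF \<E>(1), of d] by (simp add: sets_P B_max_eq_B_gen)
  have h_int: "integrable P ?h"
    using f(2) by (rule H.real_cond_exp_int(1))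
  have sint: "set_integrable P C g" if "integrable P g" "C \<in> sets P" for C and g :: "nat set set \<Rightarrow> real"
    unfolding set_integrable_def using that by (intro integrable_mult_indicator)
  have eq: "(\<integral>H\<in>C. f H \<partial>P) = (\<integral>H\<in>C. ?h H \<partial>P)" if "C \<in> B_gen d ?\<E>" for C
  proof -
    have "containing d ` {\<F>. finite \<F> \<and> \<F> \<subseteq> ?\<E>} \<subseteq> Pow (Univ d)"
      by (auto simp: containing_def)
    with Int_stable_containing show ?thesis
      using that[unfolded B_gen_eq_sigma_sets_containing]
    proof (induction rule: sigma_sets_induct_disjoint)
      case (basic C)
      then show ?case
        using set_integral_containing[OF I J inf f] by (auto simp: set_lebesgue_integral_def)
    next
      case empty
      then show ?case by (simp add: set_lebesgue_integral_def)
    next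
      case (compl C)
      then have "C \<in> sets P"
        using GP unfolding B_gen_eq_sigma_sets_containing by blast
      moreover have "(\<integral>H\<in>Univ d - C. g H \<partial>P) = (\<integral>H. g H \<partial>P) - (\<integral>H\<in>C. g H \<partial>P)"
        if g: "integrable P g" and C: "C \<in> sets P" for g :: "nat set set \<Rightarrow> real"
      proof -
        have "(\<integral>H\<in>Univ d - C. g H \<partial>P) = (\<integral>H. g H - indicator C H * g H \<partial>P)"
          unfolding set_lebesgue_integral_def
          by (intro Bochner_Integration.integral_cong) (auto simp: space_P split: split_indicator)
        then show ?thesis
          using g sint[OF g C] by (simp add: set_lebesgue_integral_def set_integrable_def)
      qed
      \<comment> \<open>Complements also need equal total integrals, which conditional expectation
        preserves.\<close>
      ultimately show ?case
        using f(2) h_int compl.IH H.real_cond_exp_int(2)[OF f(2)] by simp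
    next
      case (union C)
      have C: "C i \<in> sets P" for i
        using union.hyps(2) GP unfolding B_gen_eq_sigma_sets_containing by blast
      have "(\<integral>H\<in>(\<Union>i. C i). g H \<partial>P) = (\<Sum>i. \<integral>H\<in>C i. g H \<partial>P)"
        if "integrable P g" for g :: "nat set set \<Rightarrow> real"
        using C that disjoint_family_onD[OF union.hyps(1)]
        by (intro lebesgue_integral_countable_add sint) auto
      then show ?case
        using f(2) h_int union.IH by simp
    qed
  qed
  show ?thesis
  proof (rule G.real_cond_exp_charact)
    have "subalgebra ?G ?H"
      unfolding subalgebra_def sets_sigma_B_gen using B_gen_mono[OF \<E>\<E>', of d]
      by (simp add: sigma_algebra.space_measure_of_eq[OF sigma_algebra_B_gen])
    then show "?h \<in> borel_measurable ?G"
      by (rule measurable_from_subalg) simp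
  qed (use f(2) h_int eq in auto)
qed

text \<open>Conditioning on the full join pulls out \<open>f2\<close> and replaces \<open>f1\<close>
  by \<open>?h\<close>; conditioning further on the smaller join pulls out
  \<open>?h\<close>.\<close>

lemma rel_indep_B_sub:
  assumes I: "I \<subseteq> PosNat" and J: "\<And>i. i \<in> K \<Longrightarrow> J i \<subseteq> PosNat"
    and inf: "infinite (I \<inter> (\<Inter>i\<in>K. J i))"
  shows "rel_indep P (B_sub d I) (B_join d K (\<lambda>i. B_sub d (J i))) (B_join d K (\<lambda>i. B_sub d (I \<inter> J i)))"
  unfolding rel_indep_def B_join_B_sub space_P
proof (intro allI impI)
  let ?\<E> = "\<Union>i\<in>K. nsets (J i) d" and ?\<E>' = "\<Union>i\<in>K. nsets (I \<inter> J i) d"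
  let ?G = "sigma (Univ d) (B_gen d ?\<E>)" and ?H = "sigma (Univ d) (B_gen d ?\<E>')"
  fix f1 f2 :: "nat set set \<Rightarrow> real"
  assume "f1 \<in> borel_measurable (sigma (Univ d) (B_sub d I)) \<and> bounded (f1 ` Univ d) \<and>
      f2 \<in> borel_measurable ?G \<and> bounded (f2 ` Univ d)"
  then have f1: "f1 \<in> borel_measurable (sigma (Univ d) (B_sub d I))" "bounded (f1 ` Univ d)"
    and f2: "f2 \<in> borel_measurable ?G" "bounded (f2 ` Univ d)" by blast+
  have \<E>: "?\<E> \<subseteq> nsets PosNat d" "?\<E>' \<subseteq> nsets PosNat d" "nsets I d \<subseteq> nsets PosNat d"
    using I J by (auto intro!: Un_nsets_subset simp: nsets_def)
  have \<E>\<E>': "?\<E>' \<subseteq> ?\<E>" by (auto simp: nsets_def)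
  interpret G: finite_measure_subalgebra P ?G
    using finite_measure_subalgebra_B_gen[OF \<E>(1)] .
  interpret H: finite_measure_subalgebra P ?H
    using finite_measure_subalgebra_B_gen[OF \<E>(2)] .
  have GH: "subalgebra ?G ?H"
    unfolding subalgebra_def sets_sigma_B_gen using B_gen_mono[OF \<E>\<E>', of d]
    by (simp add: sigma_algebra.space_measure_of_eq[OF sigma_algebra_B_gen])
  have f1P: "f1 \<in> borel_measurable P"
    using f1(1) measurable_from_subalg[OF subalgebra_B_gen[OF \<E>(3)]] by (simp add: B_sub_eq_B_gen)
  have f2P: "f2 \<in> borel_measurable P"
    using f2(1) measurable_from_subalg[OF G.subalg] by blast
  obtain b where b: "\<And>H. H \<in> Univ d \<Longrightarrow> \<bar>f1 H\<bar> \<le> b"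
    using f1(2) by (auto simp: bounded_iff)
  obtain c where c: "\<And>H. H \<in> Univ d \<Longrightarrow> \<bar>f2 H\<bar> \<le> c"
    using f2(2) by (auto simp: bounded_iff)
  have f1_int: "integrable P f1"
    using f1P b by (intro integrable_const_bound[of _ b]) (auto simp: space_P)
  have mult_f2: "integrable P (\<lambda>H. g H * f2 H)" if g: "integrable P g" for g :: "nat set set \<Rightarrow> real"
  proof (rule Bochner_Integration.integrable_bound)
    show "integrable P (\<lambda>H. c * g H)" using g by simp
    show "AE H in P. norm (g H * f2 H) \<le> norm (c * g H)"
    proof (rule AE_I2)
      fix H assume "H \<in> space P"
      then have "\<bar>f2 H\<bar> \<le> \<bar>c\<bar>" using c[of H] by (simp add: space_P)
      then show "norm (g H * f2 H) \<le> norm (c * g H)"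
        by (simp add: abs_mult mult.commute[of _ "\<bar>g H\<bar>"] mult_left_mono)
    qed
  qed (use g f2P in auto)
  let ?h = "real_cond_exp P ?H f1"
  have h_int: "integrable P ?h"
    using f1_int by (rule H.real_cond_exp_int(1))
  have "AE H in P. real_cond_exp P ?G (\<lambda>H. f2 H * f1 H) H = f2 H * real_cond_exp P ?G f1 H"
    using mult_f2[OF f1_int] f2(1) f1P by (intro G.real_cond_exp_mult) (auto simp: mult.commute)
  moreover have "AE H in P. real_cond_exp P ?G f1 H = ?h H"
    by (rule real_cond_exp_B_gen_eq[OF I J inf f1(1) f1_int])
  ultimately have 1: "AE H in P. real_cond_exp P ?G (\<lambda>H. f1 H * f2 H) H = ?h H * f2 H"
    by eventually_elim (simp add: mult.commute)
  \<comment> \<open>Tower property, available because \<open>?H\<close> is a subalgebra of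
    \<open>?G\<close>.\<close>
  have "AE H in P. real_cond_exp P ?H (real_cond_exp P ?G (\<lambda>H. f1 H * f2 H)) H
      = real_cond_exp P ?H (\<lambda>H. f1 H * f2 H) H"
    by (rule H.real_cond_exp_nested_subalg[OF G.subalg GH mult_f2[OF f1_int]])
  moreover have "AE H in P. real_cond_exp P ?H (real_cond_exp P ?G (\<lambda>H. f1 H * f2 H)) H
      = real_cond_exp P ?H (\<lambda>H. ?h H * f2 H) H"
    using mult_f2[OF h_int] by (intro H.real_cond_exp_cong[OF 1]) auto
  moreover have "AE H in P. real_cond_exp P ?H (\<lambda>H. ?h H * f2 H) H = ?h H * real_cond_exp P ?H f2 H"
    using mult_f2[OF h_int] f2P by (intro H.real_cond_exp_mult) auto
  ultimately show "AE H in P. real_cond_exp P ?H (\<lambda>H. f1 H * f2 H) H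
      = real_cond_exp P ?H f1 H * real_cond_exp P ?H f2 H"
    by eventually_elim simp
qed

end

section \<open>Existence of the limit law and its properties\<close>

theorem theorem7p4:
  fixes d :: nat and V :: "nat \<Rightarrow> 'a set" and E :: "nat \<Rightarrow> 'a set set"
  assumes "d \<ge> 2"
    and "\<And>m. m \<ge> 1 \<Longrightarrow> finite (V m)"
    and "\<And>m. m \<ge> 1 \<Longrightarrow> uniform_hypergraph d (V m) (E m)"
  shows "\<exists>(r :: nat \<Rightarrow> nat) (P :: nat set set measure).
    strict_mono r \<and> 0 < r 0 \<and>
    prob_space P \<and> space P = Univ d \<and> sets P = B_max d \<and>
    (\<forall>A \<in> B_reg d. (\<lambda>i. measure (sample_law d (V (r i)) (E (r i))) A) \<longlonglongrightarrow> measure P A) \<and>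
    (\<forall>A \<in> B_max d. \<forall>\<sigma>. \<sigma> permutes PosNat \<longrightarrow> measure P (perm_event \<sigma> A) = measure P A) \<and>
    (\<forall>(I :: nat set) (l :: nat) (J :: nat \<Rightarrow> nat set).
       I \<subseteq> PosNat \<longrightarrow> (\<forall>i\<in>{1..l}. J i \<subseteq> PosNat) \<longrightarrow> infinite (I \<inter> (\<Inter>i\<in>{1..l}. J i)) \<longrightarrow>
       rel_indep P (B_sub d I) (B_join d {1..l} (\<lambda>i. B_sub d (J i)))
         (B_join d {1..l} (\<lambda>i. B_sub d (I \<inter> J i))))"
proof -
  \<comment> \<open>The shift by one is needed because the hypotheses speak of
    \<open>m \<ge> 1\<close> only; it also makes the first chosen index positive.\<close>
  define Q where "Q n = sample_law d (V (Suc n)) (E (Suc n))" for n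
  have V: "finite (V (Suc n))" "V (Suc n) \<noteq> {}" for n
    using assms(2)[of "Suc n"] assms(3)[of "Suc n"] by (auto simp: uniform_hypergraph_def)
  have Q: "prob_space (Q n)" "sets (Q n) = B_max d" for n
    unfolding Q_def by (rule prob_space_sample_law[OF V], rule sets_sample_law)
  \<comment> \<open>A diagonal subsequence exists since there are countably many regular events and
    probabilities are bounded by 1.\<close>
  obtain k :: "nat \<Rightarrow> nat" where k: "strict_mono k"
    and "\<And>A. A \<in> B_reg d \<Longrightarrow> \<exists>l. (\<lambda>n. measure (Q (k n)) A) \<longlonglongrightarrow> l"
    by (rule function_convergent_subsequence[OF countable_B_reg[of d], of "\<lambda>n A. measure (Q n) A" 1])
       (auto simp: prob_space.prob_le_1[OF Q(1)])
  then obtain l where l: "\<And>A. A \<in> B_reg d \<Longrightarrow> (\<lambda>n. measure (Q (k n)) A) \<longlonglongrightarrow> l A"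
    by metis
  obtain P where P: "prob_space P" "space P = Univ d" "sets P = B_max d"
    and lP: "\<And>A. A \<in> B_reg d \<Longrightarrow> measure P A = l A"
    by (rule limit_law[of "\<lambda>n. Q (k n)" d l]) (use Q l in auto)
  have "measure P (perm_event \<sigma> A) = measure P A" if A: "A \<in> B_reg d" and \<sigma>: "\<sigma> permutes PosNat" for A \<sigma>
  proof -
    have \<sigma>A: "perm_event \<sigma> A \<in> B_reg d" by (rule perm_event_B_reg[OF \<sigma> A])
    have "measure (Q (k n)) (perm_event \<sigma> A) = measure (Q (k n)) A" for n
      unfolding Q_def using A \<sigma>A B_reg_subset_B_max
      by (intro sample_law_exchangeable[OF V \<sigma>]) auto
    then show ?thesis
      using LIMSEQ_unique[OF l[OF \<sigma>A]] l[OF A] by (simp add: lP A \<sigma>A)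
  qed
  then have distr: "distr P P (relabel \<sigma>) = P" if "\<sigma> permutes PosNat" for \<sigma>
    using that by (intro distr_relabel[OF P])
  interpret exchangeable_law P d
    using P distr by (intro exchangeable_law.intro exchangeable_law_axioms.intro)
  \<comment> \<open>The push-forward under \<open>relabel\<close> evaluates events moved by the
    inverse, so it is taken along \<open>inv \<sigma>\<close>.\<close>
  have inv: "measure P (perm_event \<sigma> A) = measure P A" if "A \<in> B_max d" "\<sigma> permutes PosNat" for A \<sigma>
    using distr_relabel_vimage[OF P(2,3) permutes_inv[OF that(2)] that(1)]
    by (simp add: distr[OF permutes_inv[OF that(2)]] permutes_inv_inv[OF that(2)] measure_def)
  show ?thesis
  proof (intro exI[of _ "\<lambda>i. Suc (k i)"] exI[of _ P] conjI ballI allI impI)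
    show "strict_mono (\<lambda>i. Suc (k i))"
      using k by (simp add: strict_mono_def)
    show "(\<lambda>i. measure (sample_law d (V (Suc (k i))) (E (Suc (k i)))) A) \<longlonglongrightarrow> measure P A"
      if "A \<in> B_reg d" for A
      using l[OF that] by (simp add: lP[OF that] Q_def)
    show "rel_indep P (B_sub d I) (B_join d {1..n} (\<lambda>i. B_sub d (J i)))
         (B_join d {1..n} (\<lambda>i. B_sub d (I \<inter> J i)))"
      if "I \<subseteq> PosNat" "\<forall>i\<in>{1..n}. J i \<subseteq> PosNat" "infinite (I \<inter> (\<Inter>i\<in>{1..n}. J i))"
      for I n and J :: "nat \<Rightarrow> nat set"
      using that by (intro rel_indep_B_sub) blast+
  qed (fact P inv | simp)+
qed

end
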